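(* Let $\mathcal N$ be a $*$-subalgebra of $\mathcal B(\mathcal H)$ with $\mathcal N\neq\mathbb C\mathbb I$ and $\mathcal N\neq\mathcal B(\mathcal H)$, let $E_{\mathcal N}$ be a conditional expectation onto $\mathcal N$ such that $\sigma_{\mathrm{Tr}}:=E_{\mathcal N*}(\mathbb I/d_{\mathcal H})$ is full rank, and consider the Lindbladian $\mathcal L_{\mathcal N}:=E_{\mathcal N}-\mathrm{id}$. If $\alpha\ge0$ is such that $\alpha\,\mathrm{Ent}_{2,\mathcal N}(X)\le\mathcal E_{2,\mathcal L_{\mathcal N}}(X)$ for all positive semidefinite $X\in\mathcal B(\mathcal H)$, then $\alpha=0$.
   Context: $\mathcal H$ is a finite-dimensional complex Hilbert space of dimension $d_{\mathcal H}$. A conditional expectation onto $\mathcal N$ is a unital completely positive projection $E_{\mathcal N}:\mathcal B(\mathcal H)\to\mathcal N$ with $E_{\mathcal N}[AXB]=AE_{\mathcal N}[X]B$ for $A,B\in\mathcal N$; $E_{\mathcal N*}$ is its predual ($\mathrm{Tr}[E_{\mathcal N*}(X)Y]=\mathrm{Tr}[XE_{\mathcal N}[Y]]$). Put $\Gamma^s(X)=\sigma_{\mathrm{Tr}}^{s/2}X\sigma_{\mathrm{Tr}}^{s/2}$ and $\langle X,Y\rangle_{\sigma_{\mathrm{Tr}}}=\mathrm{Tr}[\sigma_{\mathrm{Tr}}^{1/2}X^*\sigma_{\mathrm{Tr}}^{1/2}Y]$. Dirichlet form: $\mathcal E_{2,\mathcal L_{\mathcal N}}(X)=-\langle X,\mathcal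 L_{\mathcal N}(X)\rangle_{\sigma_{\mathrm{Tr}}}$. Entropy: with $Z=\Gamma^{1/2}(X)$, $\mathrm{Ent}_{2,\mathcal N}(X)=\mathrm{Tr}\big[Z^2\big(\ln Z-\frac12\ln E_{\mathcal N}[\sigma_{\mathrm{Tr}}^{-1/2}Z^2\sigma_{\mathrm{Tr}}^{-1/2}]-\frac12\ln\sigma_{\mathrm{Tr}}\big)\big]$ (with the convention $0\ln0=0$). *)

theory Defs
  imports Complex_Main "Jordan_Normal_Form.Determinant"
begin

text \<open>Matrices in B(H), H = C^n, are represented as complex n x n matrices
  (elements of carrier_mat n n). d_H = n.\<close>

definition mtrace :: "complex mat \<Rightarrow> complex" where
  "mtrace A = (\<Sum>i<dim_row A. A $$ (i,i))"

definition adj :: "complex mat \<Rightarrow> complex mat" where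
  "adj A = mat (dim_col A) (dim_row A) (\<lambda>(i,j). cnj (A $$ (j,i)))"

definition psd :: "nat \<Rightarrow> complex mat \<Rightarrow> bool" where
  "psd n A \<longleftrightarrow> A \<in> carrier_mat n n \<and> adj A = A \<and>
     (\<forall>v \<in> carrier_vec n. 0 \<le> Re (\<Sum>i<n. cnj (v $ i) * (A *\<^sub>v v) $ i))"

definition unitary :: "nat \<Rightarrow> complex mat \<Rightarrow> bool" where
  "unitary n U \<longleftrightarrow> U \<in> carrier_mat n n \<and> adj U * U = 1\<^sub>m n"

definition matfun :: "nat \<Rightarrow> (real \<Rightarrow> real) \<Rightarrow> complex mat \<Rightarrow> complex mat" where
  "matfun n f A = (SOME B. \<exists>U d. unitary n U \<and>
      A = U * mat_diag n (\<lambda>i. complex_of_real (d i)) * adj U \<and>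
      B = U * mat_diag n (\<lambda>i. complex_of_real (f (d i))) * adj U)"

definition star_subalgebra :: "nat \<Rightarrow> complex mat set \<Rightarrow> bool" where
  "star_subalgebra n N \<longleftrightarrow> N \<subseteq> carrier_mat n n \<and> 0\<^sub>m n n \<in> N \<and>
     (\<forall>A\<in>N. \<forall>B\<in>N. A + B \<in> N \<and> A * B \<in> N) \<and>
     (\<forall>c. \<forall>A\<in>N. c \<cdot>\<^sub>m A \<in> N) \<and> (\<forall>A\<in>N. adj A \<in> N)"

definition block_mat :: "nat \<Rightarrow> nat \<Rightarrow> (nat \<Rightarrow> nat \<Rightarrow> complex mat) \<Rightarrow> complex mat" where
  "block_mat k n X = mat (k*n) (k*n) (\<lambda>(a,b). X (a div n) (b div n) $$ (a mod n, b mod n))"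

definition completely_positive :: "nat \<Rightarrow> (complex mat \<Rightarrow> complex mat) \<Rightarrow> bool" where
  "completely_positive n E \<longleftrightarrow> (\<forall>k X. (\<forall>i<k. \<forall>j<k. X i j \<in> carrier_mat n n) \<longrightarrow>
      psd (k*n) (block_mat k n X) \<longrightarrow> psd (k*n) (block_mat k n (\<lambda>i j. E (X i j))))"

definition cond_exp :: "nat \<Rightarrow> complex mat set \<Rightarrow> (complex mat \<Rightarrow> complex mat) \<Rightarrow> bool" where
  "cond_exp n N E \<longleftrightarrow>
     E ` carrier_mat n n = N \<and>
     (\<forall>X\<in>carrier_mat n n. E (E X) = E X) \<and>
     (\<forall>X\<in>carrier_mat n n. \<forall>Y\<in>carrier_mat n n. E (X + Y) = E X + E Y) \<and>
     (\<forall>c. \<forall>X\<in>carrier_mat n n. E (c \<cdot>\<^sub>m X) = c \<cdot>\<^sub>m E X) \<and>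
     E (1\<^sub>m n) = 1\<^sub>m n \<and>
     completely_positive n E \<and>
     (\<forall>A\<in>N. \<forall>B\<in>N. \<forall>X\<in>carrier_mat n n. E (A * X * B) = A * E X * B)"

definition predual :: "nat \<Rightarrow> (complex mat \<Rightarrow> complex mat) \<Rightarrow> complex mat \<Rightarrow> complex mat" where
  "predual n E X = (THE S. S \<in> carrier_mat n n \<and>
      (\<forall>Y\<in>carrier_mat n n. mtrace (S * Y) = mtrace (X * E Y)))"

definition sigma_tr :: "nat \<Rightarrow> (complex mat \<Rightarrow> complex mat) \<Rightarrow> complex mat" where
  "sigma_tr n E = predual n E (complex_of_real (1 / real n) \<cdot>\<^sub>m 1\<^sub>m n)"

definition spow :: "nat \<Rightarrow> (complex mat \<Rightarrow> complex mat) \<Rightarrow> real \<Rightarrow> complex mat" where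
  "spow n E p = matfun n (\<lambda>t. t powr p) (sigma_tr n E)"

definition Gamma :: "nat \<Rightarrow> (complex mat \<Rightarrow> complex mat) \<Rightarrow> real \<Rightarrow> complex mat \<Rightarrow> complex mat" where
  "Gamma n E s X = spow n E (s/2) * X * spow n E (s/2)"

definition sigma_inner :: "nat \<Rightarrow> (complex mat \<Rightarrow> complex mat) \<Rightarrow> complex mat \<Rightarrow> complex mat \<Rightarrow> complex" where
  "sigma_inner n E X Y = mtrace (spow n E (1/2) * adj X * spow n E (1/2) * Y)"

definition lindbladian :: "(complex mat \<Rightarrow> complex mat) \<Rightarrow> complex mat \<Rightarrow> complex mat" where
  "lindbladian E X = E X - X"

text \<open>Dirichlet form (real part; the value is real for Hermitian X).\<close>
definition dirichlet2 :: "nat \<Rightarrow> (complex mat \<Rightarrow> complex mat) \<Rightarrow> complex mat \<Rightarrow> real" where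
  "dirichlet2 n E X = - Re (sigma_inner n E X (lindbladian E X))"

text \<open>Entropy Ent_{2,N}; ln is the real logarithm (ln 0 = 0 in Isabelle), which
  realises the convention 0 ln 0 = 0.\<close>
definition ent2 :: "nat \<Rightarrow> (complex mat \<Rightarrow> complex mat) \<Rightarrow> complex mat \<Rightarrow> real" where
  "ent2 n E X = (let Z = Gamma n E (1/2) X in
     Re (mtrace (Z * Z * (matfun n ln Z
        - complex_of_real (1/2) \<cdot>\<^sub>m matfun n ln
             (E (spow n E (-1/2) * (Z * Z) * spow n E (-1/2)))
        - complex_of_real (1/2) \<cdot>\<^sub>m matfun n ln (sigma_tr n E)))))"

end

theory Submission
  imports Defs "Jordan_Normal_Form.Schur_Decomposition" "Jordan_Normal_Form.Spectral_Radius"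
    "HOL-Real_Asymp.Real_Asymp"
begin

text \<open>
  The state \<open>\<sigma>\<close> commutes with \<open>N\<close>, so \<open>\<sigma>\<close> and a nontrivial projection \<open>P \<in> N\<close> are diagonal in a common
  orthonormal basis. Since \<open>N\<close> is not the full matrix algebra, some matrix unit \<open>e\<^sub>i\<^sub>j\<close> of that basis with
  \<open>i\<close> in and \<open>j\<close> outside the range of \<open>P\<close> is not in \<open>N\<close>: the off-diagonal units generate everything.
  Rotate \<open>Z = \<sigma>\<^sup>1\<^sup>/\<^sup>2 P\<close> in the plane of \<open>i, j\<close> by an angle with sine \<open>\<epsilon>\<close> and put
  \<open>X = \<sigma>\<^sup>-\<^sup>1\<^sup>/\<^sup>4 Z \<sigma>\<^sup>-\<^sup>1\<^sup>/\<^sup>4 = P + O(\<epsilon>)\<close>. As \<open>P \<in> N\<close>, the Dirichlet form of \<open>X\<close> is \<open>O(\<epsilon>\<^sup>2)\<close>.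
  The rotation leaves the spectrum of \<open>Z\<close> unchanged, so the entropy is \<open>O(\<epsilon>\<^sup>2) - Tr (G ln G) / 2n\<close>, where
  \<open>G = E (\<sigma>\<^sup>-\<^sup>1\<^sup>/\<^sup>2 Z\<^sup>2 \<sigma>\<^sup>-\<^sup>1\<^sup>/\<^sup>2) = P + O(\<epsilon>)\<close> has eigenvalues near 0 of total size at least a
  constant times \<open>\<epsilon>\<^sup>2\<close>: the constant is positive by faithfulness of \<open>E\<close> applied to \<open>e\<^sub>i\<^sub>j - E e\<^sub>i\<^sub>j \<noteq> 0\<close>.
  Hence the entropy is at least of order \<open>\<epsilon>\<^sup>2 ln (1/\<epsilon>)\<close>.
  Eigenvalue perturbation theory is avoided by the scalar inequality
  \<open>g ln g \<le> ln \<delta> g (1 - g)\<^sup>2 + (g - g\<^sup>2)\<^sup>2 / \<delta> + g\<^sup>2 (g - 1)\<close> with \<open>\<delta> = \<epsilon>\<^sup>2\<close>, which only involves traces of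
  polynomials in \<open>G\<close>, together with \<open>G - G\<^sup>2 = O(\<epsilon>\<^sup>2)\<close>.
\<close>

section \<open>Adjoint, trace and spectral form\<close>

lemma square_mult_carrier [simp]:
  "A \<in> carrier_mat n n \<Longrightarrow> B \<in> carrier_mat n n \<Longrightarrow> A * B \<in> carrier_mat n n"
  by (rule mult_carrier_mat)

lemma square_minus_carrier [simp]:
  "B \<in> carrier_mat n n \<Longrightarrow> A - B \<in> carrier_mat n n"
  by (rule minus_carrier_mat)

lemma square_assoc:
  fixes A B C :: "complex mat"
  assumes "A \<in> carrier_mat n n" "B \<in> carrier_mat n n" "C \<in> carrier_mat n n"
  shows "(A * B) * C = A * (B * C)"
  using assms by (rule assoc_mult_mat)

lemma square_one [simp]:
  fixes A :: "complex mat"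
  assumes "A \<in> carrier_mat n n"
  shows "1\<^sub>m n * A = A" "A * 1\<^sub>m n = A"
  using assms by auto

lemma smult_one_mat [simp]: "(1::complex) \<cdot>\<^sub>m A = A"
  by (rule eq_matI) auto

lemma smult_smult_mat: "(a::complex) \<cdot>\<^sub>m (b \<cdot>\<^sub>m A) = (a * b) \<cdot>\<^sub>m A"
  by (rule eq_matI) auto

lemma square_distrib:
  fixes A B C :: "complex mat"
  assumes "A \<in> carrier_mat n n" "B \<in> carrier_mat n n" "C \<in> carrier_mat n n"
  shows "A * (B + C) = A * B + A * C" "(A + B) * C = A * C + B * C"
    "A * (B - C) = A * B - A * C" "(A - B) * C = A * C - B * C"
  using assms by (auto simp: mult_add_distrib_mat[of _ n n] add_mult_distrib_mat[of _ n n]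
      mult_minus_distrib_mat[of _ n n] minus_mult_distrib_mat[of _ n n])

lemma square_smult:
  fixes A B :: "complex mat"
  assumes "A \<in> carrier_mat n n" "B \<in> carrier_mat n n"
  shows "A * (c \<cdot>\<^sub>m B) = c \<cdot>\<^sub>m (A * B)" "(c \<cdot>\<^sub>m A) * B = c \<cdot>\<^sub>m (A * B)"
  using assms by (auto simp: mult_smult_distrib[of _ n n] mult_smult_assoc_mat[of _ n n])

lemma adj_carrier [simp]: "A \<in> carrier_mat r c \<Longrightarrow> adj A \<in> carrier_mat c r"
  unfolding adj_def by auto

lemma adj_dim [simp]: "dim_row (adj A) = dim_col A" "dim_col (adj A) = dim_row A"
  unfolding adj_def by auto

lemma adj_index [simp]: "i < dim_col A \<Longrightarrow> j < dim_row A \<Longrightarrow> adj A $$ (i,j) = cnj (A $$ (j,i))"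
  unfolding adj_def by auto

lemma adj_adj [simp]: "adj (adj A) = A"
  by (rule eq_matI) auto

lemma adj_one [simp]: "adj (1\<^sub>m n) = 1\<^sub>m n"
  by (rule eq_matI) auto

lemma adj_add: "A \<in> carrier_mat r c \<Longrightarrow> B \<in> carrier_mat r c \<Longrightarrow> adj (A + B) = adj A + adj B"
  by (rule eq_matI) auto

lemma adj_minus: "A \<in> carrier_mat r c \<Longrightarrow> B \<in> carrier_mat r c \<Longrightarrow> adj (A - B) = adj A - adj B"
  by (rule eq_matI) auto

lemma adj_smult: "adj (c \<cdot>\<^sub>m A) = cnj c \<cdot>\<^sub>m adj A"
  by (rule eq_matI) auto

lemma adj_mult:
  assumes "A \<in> carrier_mat r m" "B \<in> carrier_mat m c"
  shows "adj (A * B) = adj B * adj A"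
  using assms by (intro eq_matI) (auto simp: scalar_prod_def ac_simps)

lemma adj_mat_diag [simp]:
  "adj (mat_diag n (\<lambda>i. complex_of_real (d i))) = mat_diag n (\<lambda>i. complex_of_real (d i))"
  by (rule eq_matI) (auto simp: mat_diag_def)

lemma mtrace_add:
  "A \<in> carrier_mat n n \<Longrightarrow> B \<in> carrier_mat n n \<Longrightarrow> mtrace (A + B) = mtrace A + mtrace B"
  unfolding mtrace_def by (auto simp: sum.distrib)

lemma mtrace_minus:
  "A \<in> carrier_mat n n \<Longrightarrow> B \<in> carrier_mat n n \<Longrightarrow> mtrace (A - B) = mtrace A - mtrace B"
  unfolding mtrace_def by (auto simp: sum_subtractf)

lemma mtrace_smult: "A \<in> carrier_mat n n \<Longrightarrow> mtrace (c \<cdot>\<^sub>m A) = c * mtrace A"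
  unfolding mtrace_def by (auto simp: sum_distrib_left)

lemma mtrace_adj: "A \<in> carrier_mat n n \<Longrightarrow> mtrace (adj A) = cnj (mtrace A)"
  unfolding mtrace_def by auto

lemma mtrace_mult:
  assumes "A \<in> carrier_mat n n" "B \<in> carrier_mat n n"
  shows "mtrace (A * B) = (\<Sum>i<n. \<Sum>k<n. A $$ (i,k) * B $$ (k,i))"
  using assms unfolding mtrace_def by (auto simp: scalar_prod_def atLeast0LessThan)

lemma mtrace_commute:
  assumes "A \<in> carrier_mat n n" "B \<in> carrier_mat n n"
  shows "mtrace (A * B) = mtrace (B * A)"
  unfolding mtrace_mult[OF assms] mtrace_mult[OF assms(2,1)]
  by (subst sum.swap) (simp add: mult.commute)

lemma mtrace_adj_mult_self:
  assumes "Q \<in> carrier_mat n n"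
  shows "mtrace (adj Q * Q) = complex_of_real (\<Sum>i<n. \<Sum>k<n. (cmod (Q $$ (k,i)))\<^sup>2)"
  using assms by (subst mtrace_mult[of _ n]) (auto simp: complex_norm_square mult.commute of_real_sum simp del: of_real_power intro!: sum.cong)

section \<open>Matrices diagonalised by a unitary, and real functions of them\<close>

definition sform :: "nat \<Rightarrow> complex mat \<Rightarrow> (nat \<Rightarrow> real) \<Rightarrow> complex mat" where
  "sform n U d = U * mat_diag n (\<lambda>i. complex_of_real (d i)) * adj U"

lemma mat_diag_dims [simp]: "dim_row (mat_diag n f) = n" "dim_col (mat_diag n f) = n"
  by (simp_all add: mat_diag_def)

lemma unitary_carrier [simp]: "unitary n U \<Longrightarrow> U \<in> carrier_mat n n"
  by (simp add: unitary_def)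

lemma unitary_left: "unitary n U \<Longrightarrow> adj U * U = 1\<^sub>m n"
  by (simp add: unitary_def)

lemma unitary_right: "unitary n U \<Longrightarrow> U * adj U = 1\<^sub>m n"
  using mat_mult_left_right_inverse[of "adj U" n U] by (simp add: unitary_def)

lemma unitary_mult:
  assumes "unitary n U" "unitary n V"
  shows "unitary n (U * V)"
proof -
  have c [simp]: "U \<in> carrier_mat n n" "V \<in> carrier_mat n n" using assms by auto
  have "adj (U * V) * (U * V) = adj V * (adj U * U) * V"
    by (simp add: adj_mult[of _ n n _ n] square_assoc[of _ n])
  also have "\<dots> = 1\<^sub>m n" using assms c
    by (simp add: unitary_left )
  finally show ?thesis by (simp add: unitary_def)
qed

lemma conj_unitary_mult:
  assumes "unitary n U" "A \<in> carrier_mat n n" "B \<in> carrier_mat n n"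
  shows "(U * A * adj U) * (U * B * adj U) = U * (A * B) * adj U"
proof -
  have c [simp]: "U \<in> carrier_mat n n" using assms by auto
  have "(U * A * adj U) * (U * B * adj U) = U * A * (adj U * U) * B * adj U"
    using assms(2,3) by (simp add: square_assoc[of _ n])
  then show ?thesis using assms by (simp add: unitary_left square_assoc[of _ n])
qed

lemma mtrace_conj_unitary:
  assumes "unitary n U" "A \<in> carrier_mat n n"
  shows "mtrace (U * A * adj U) = mtrace A"
proof -
  have c [simp]: "U \<in> carrier_mat n n" using assms by auto
  have "mtrace (U * A * adj U) = mtrace (adj U * (U * A))"
    using assms(2) by (intro mtrace_commute[of _ n]) auto
  also have "adj U * (U * A) = (adj U * U) * A" using assms(2) by (simp add: square_assoc[of _ n])
  finally show ?thesis using assms by (simp add: unitary_left)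
qed

lemma sform_carrier [simp]: "unitary n U \<Longrightarrow> sform n U d \<in> carrier_mat n n"
  unfolding sform_def by (auto intro!: mult_carrier_mat[of _ n n])

lemma adj_sform [simp]: "unitary n U \<Longrightarrow> adj (sform n U d) = sform n U d"
  unfolding sform_def
  by (simp add: adj_mult[of _ n n _ n] square_assoc[of _ n])

lemma sform_mult:
  assumes "unitary n U"
  shows "sform n U f * sform n U g = sform n U (\<lambda>i. f i * g i)"
  unfolding sform_def by (subst conj_unitary_mult[OF assms]) auto

lemma sform_add:
  assumes "unitary n U"
  shows "sform n U f + sform n U g = sform n U (\<lambda>i. f i + g i)"
proof -
  have "mat_diag n (\<lambda>i. complex_of_real (f i + g i))
      = mat_diag n (\<lambda>i. complex_of_real (f i)) + mat_diag n (\<lambda>i. complex_of_real (g i))"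
    by (rule eq_matI) (auto simp: mat_diag_def)
  then show ?thesis unfolding sform_def using assms
    by (simp add: square_distrib[of _ n])
qed

lemma sform_smult:
  assumes "unitary n U"
  shows "complex_of_real c \<cdot>\<^sub>m sform n U f = sform n U (\<lambda>i. c * f i)"
proof -
  have "mat_diag n (\<lambda>i. complex_of_real (c * f i))
      = complex_of_real c \<cdot>\<^sub>m mat_diag n (\<lambda>i. complex_of_real (f i))"
    by (rule eq_matI) (auto simp: mat_diag_def)
  then show ?thesis unfolding sform_def using assms
    by (simp add: square_smult[of _ n])
qed

lemma sform_const:
  assumes "unitary n U"
  shows "sform n U (\<lambda>i. c) = complex_of_real c \<cdot>\<^sub>m 1\<^sub>m n"
proof -
  have "sform n U (\<lambda>i. 1) = 1\<^sub>m n"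
    unfolding sform_def using assms by (simp add: unitary_right )
  then show ?thesis using sform_smult[OF assms, of c "\<lambda>i. 1"] by simp
qed

lemma mtrace_sform:
  assumes "unitary n U"
  shows "mtrace (sform n U f) = complex_of_real (\<Sum>i<n. f i)"
  unfolding sform_def
  by (subst mtrace_conj_unitary[OF assms]) (auto simp: mtrace_def mat_diag_def)

lemma sform_cong: "(\<And>i. i < n \<Longrightarrow> f i = g i) \<Longrightarrow> sform n U f = sform n U g"
proof -
  assume "\<And>i. i < n \<Longrightarrow> f i = g i"
  then have "mat_diag n (\<lambda>i. complex_of_real (f i)) = mat_diag n (\<lambda>i. complex_of_real (g i))"
    by (intro eq_matI) (auto simp: mat_diag_def)
  then show ?thesis by (simp add: sform_def)
qed

text \<open>Entry by entry, the hypothesis says that \<open>W $$ (i,j)\<close> vanishes or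
  \<open>d i = d' j\<close>; in the latter case also \<open>f (d i) = f (d' j)\<close>.\<close>

lemma mat_diag_intertwine:
  fixes d d' :: "nat \<Rightarrow> real" and f :: "real \<Rightarrow> real"
  assumes W: "W \<in> carrier_mat n n"
    and eq: "mat_diag n (\<lambda>i. complex_of_real (d i)) * W = W * mat_diag n (\<lambda>i. complex_of_real (d' i))"
  shows "mat_diag n (\<lambda>i. complex_of_real (f (d i))) * W = W * mat_diag n (\<lambda>i. complex_of_real (f (d' i)))"
proof (rule eq_matI)
  fix i j
  assume "i < dim_row (W * mat_diag n (\<lambda>i. complex_of_real (f (d' i))))"
    and "j < dim_col (W * mat_diag n (\<lambda>i. complex_of_real (f (d' i))))"
  then have ij: "i < n" "j < n" using W by (auto simp: mat_diag_def)
  have "(mat_diag n (\<lambda>i. complex_of_real (d i)) * W) $$ (i,j)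
      = (W * mat_diag n (\<lambda>i. complex_of_real (d' i))) $$ (i,j)" using eq by simp
  then have "complex_of_real (d i) * W $$ (i,j) = W $$ (i,j) * complex_of_real (d' j)"
    using ij by (simp add: mat_diag_mult_left[OF W] mat_diag_mult_right[OF W])
  then have "W $$ (i,j) = 0 \<or> d i = d' j" by auto
  then show "(mat_diag n (\<lambda>i. complex_of_real (f (d i))) * W) $$ (i,j)
      = (W * mat_diag n (\<lambda>i. complex_of_real (f (d' i)))) $$ (i,j)"
    using ij by (auto simp: mat_diag_mult_left[OF W] mat_diag_mult_right[OF W])
qed (use W in auto)

text \<open>Passing to \<open>adj U * C * V\<close> reduces this to diagonal matrices. With
  \<open>C\<close> the identity it makes the functional calculus independent of the diagonalisation;
  with \<open>U = V\<close> and \<open>d = d'\<close> it shows that whatever commutes with a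
  Hermitian matrix commutes with its functions.\<close>

lemma sform_intertwine:
  assumes U: "unitary n U" and V: "unitary n V" and C: "C \<in> carrier_mat n n"
    and eq: "sform n U d * C = C * sform n V d'"
  shows "sform n U (\<lambda>i. f (d i)) * C = C * sform n V (\<lambda>i. f (d' i))"
proof -
  have c [simp]: "U \<in> carrier_mat n n" "V \<in> carrier_mat n n" using U V by auto
  note a = square_assoc[of _ n]
  let ?D = "\<lambda>d. mat_diag n (\<lambda>i. complex_of_real (d i))"
  define W where "W = adj U * C * V"
  have W: "W \<in> carrier_mat n n" unfolding W_def using C by (auto intro!: mult_carrier_mat[of _ n n])
  have L: "adj U * (sform n U d * C) * V = ?D d * W" for d
  proof -
    have "adj U * (sform n U d * C) * V = (adj U * U) * ?D d * W"
      unfolding sform_def W_def using C by (simp add: a)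
    then show ?thesis using W by (simp add: unitary_left[OF U])
  qed
  have R: "adj U * (C * sform n V d) * V = W * ?D d" for d
  proof -
    have "adj U * (C * sform n V d) * V = W * ?D d * (adj V * V)"
      unfolding sform_def W_def using C by (simp add: a)
    then show ?thesis using W by (simp add: unitary_left[OF V] a)
  qed
  have inv: "U * (adj U * Y * V) * adj V = Y" if "Y \<in> carrier_mat n n" for Y
  proof -
    have "U * (adj U * Y * V) * adj V = (U * adj U) * Y * (V * adj V)"
      using that by (simp add: a)
    then show ?thesis using that by (simp add: unitary_right[OF V] unitary_right[OF U])
  qed
  have "?D d * W = W * ?D d'" using eq L R by metis
  then have "?D (\<lambda>i. f (d i)) * W = W * ?D (\<lambda>i. f (d' i))" using mat_diag_intertwine[OF W] by blast
  then have "adj U * (sform n U (\<lambda>i. f (d i)) * C) * V = adj U * (C * sform n V (\<lambda>i. f (d' i))) * V"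
    unfolding L R .
  then show ?thesis using inv C U V by (metis mult_carrier_mat sform_carrier)
qed

lemma sform_unique:
  assumes U: "unitary n U" and V: "unitary n V" and eq: "sform n U d = sform n V d'"
  shows "sform n U (\<lambda>i. f (d i)) = sform n V (\<lambda>i. f (d' i))"
  using sform_intertwine[OF U V one_carrier_mat, of d d' f] eq
    sform_carrier[OF U] sform_carrier[OF V] by (metis left_mult_one_mat right_mult_one_mat)

text \<open>\<open>matfun\<close> takes some diagonalisation by Hilbert choice. By uniqueness all of
  them give the same matrix, so it can be computed in whichever basis is convenient.\<close>

lemma matfun_sform:
  assumes U: "unitary n U"
  shows "matfun n f (sform n U d) = sform n U (\<lambda>i. f (d i))"
  unfolding matfun_def sform_def[symmetric]
proof (rule some_equality)
  show "\<exists>Ua da. unitary n Ua \<and> sform n U d = sform n Ua da \<and>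
      sform n U (\<lambda>i. f (d i)) = sform n Ua (\<lambda>i. f (da i))" using U by blast
next
  fix B assume "\<exists>Ua da. unitary n Ua \<and> sform n U d = sform n Ua da \<and> B = sform n Ua (\<lambda>i. f (da i))"
  then show "B = sform n U (\<lambda>i. f (d i))" using sform_unique[OF U] by metis
qed

section \<open>The spectral theorem\<close>

text \<open>Complete \<open>v\<close> to a basis and apply Gram-Schmidt, which keeps the first
  vector. The orthogonal vectors are normalised afterwards, so \<open>c\<close> is the inverse of
  the norm of \<open>v\<close>.\<close>

lemma unitary_with_first_column:
  fixes v :: "complex vec"
  assumes v: "v \<in> carrier_vec n" and v0: "v \<noteq> 0\<^sub>v n"
  obtains U c where "unitary n U" "c \<noteq> 0" "col U 0 = c \<cdot>\<^sub>v v"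
proof -
  interpret cof_vec_space n "TYPE(complex)" .
  have n: "n > 0" using v v0 by (cases n) auto
  define b where "b = basis_completion v"
  define ws where "ws = gram_schmidt n b"
  from basis_completion[OF v v0, folded b_def]
  have span_b: "span (set b) = carrier_vec n" and dist_b: "distinct b"
    and indep: "\<not> lin_dep (set b)" and b: "set b \<subseteq> carrier_vec n" and hdb: "hd b = v"
    and len_b: "length b = n" by auto
  from hdb len_b n obtain vs where bv: "b = v # vs" by (cases b, auto)
  from gram_schmidt_result[OF b dist_b indep refl, folded ws_def]
  have ws: "set ws \<subseteq> carrier_vec n" "corthogonal ws" "length ws = n"
    by (auto simp: len_b)
  from gram_schmidt_hd[OF v, of vs, folded bv] have hdws: "hd ws = v" unfolding ws_def .
  have ws0: "ws ! 0 = v" using hdws ws(3) n by (cases ws) auto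
  have wsc: "ws ! j \<in> carrier_vec n" if "j < n" for j using ws that by auto
  define nr where "nr j = sqrt (\<Sum>i<n. (cmod (ws ! j $ i))\<^sup>2)" for j
  have ip: "ws ! j \<bullet>c ws ! k = (\<Sum>i<n. ws ! j $ i * cnj (ws ! k $ i))" if "j < n" "k < n" for j k
    using wsc[OF that(1)] wsc[OF that(2)] by (auto simp: scalar_prod_def atLeast0LessThan)
  have ipn: "ws ! j \<bullet>c ws ! j = complex_of_real ((nr j)\<^sup>2)" if "j < n" for j
    unfolding ip[OF that that] nr_def
    by (simp add: sum_nonneg complex_norm_square[symmetric])
  have nr0: "nr j \<noteq> 0" if "j < n" for j
    using corthogonalD[OF ws(2), of j j] ipn[OF that] ws(3) that by auto
  define U where "U = mat n n (\<lambda>(i,j). ws ! j $ i / complex_of_real (nr j))"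
  have "adj U * U = 1\<^sub>m n"
  proof (rule eq_matI)
    fix j k assume "j < dim_row (1\<^sub>m n)" "k < dim_col (1\<^sub>m n)"
    then have jk: "j < n" "k < n" by auto
    \<comment> \<open>The conjugate sits on the second argument of \<open>\<bullet>c\<close>, hence
      the exchanged order of \<open>j\<close> and \<open>k\<close>.\<close>
    have "(adj U * U) $$ (j,k) = (ws ! k \<bullet>c ws ! j) / (complex_of_real (nr j) * complex_of_real (nr k))"
      unfolding ip[OF jk(2,1)] using jk
      by (simp add: U_def scalar_prod_def atLeast0LessThan sum_divide_distrib field_simps)
    also have "\<dots> = (1\<^sub>m n) $$ (j,k)"
    proof (cases "j = k")
      case True
      then show ?thesis using ipn[OF jk(1)] nr0[OF jk(1)] jk by (simp add: power2_eq_square)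
    next
      case False
      then show ?thesis using corthogonalD[OF ws(2), of k j] ws(3) jk by simp
    qed
    finally show "(adj U * U) $$ (j,k) = (1\<^sub>m n) $$ (j,k)" .
  qed (auto simp: U_def)
  then have "unitary n U" by (auto simp: unitary_def U_def)
  moreover have "col U 0 = (1 / complex_of_real (nr 0)) \<cdot>\<^sub>v v"
    using n v ws0 by (intro eq_vecI) (auto simp: U_def)
  ultimately show ?thesis using nr0[OF n] by (intro that[of U "1 / complex_of_real (nr 0)"]) auto
qed

lemma block_diag_mult:
  fixes A B :: "complex mat"
  assumes "A \<in> carrier_mat 1 1" "A' \<in> carrier_mat 1 1" "B \<in> carrier_mat m m" "B' \<in> carrier_mat m m"
  shows "four_block_mat A (0\<^sub>m 1 m) (0\<^sub>m m 1) B * four_block_mat A' (0\<^sub>m 1 m) (0\<^sub>m m 1) B'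
    = four_block_mat (A * A') (0\<^sub>m 1 m) (0\<^sub>m m 1) (B * B')"
  using assms
  by (subst mult_four_block_mat[of _ 1 1 _ m _ m _ _ 1 _ m])
    (auto simp: left_mult_zero_mat[of _ m m] right_mult_zero_mat[of _ m m]
      left_mult_zero_mat[of _ 1 1] right_mult_zero_mat[of _ 1 1] mult_carrier_mat[of _ m m] mult_carrier_mat[of _ 1 1])

lemma unitary_four_block:
  assumes V: "unitary m V"
  shows "unitary (Suc m) (four_block_mat (1\<^sub>m 1) (0\<^sub>m 1 m) (0\<^sub>m m 1) V)"
proof -
  have c [simp]: "V \<in> carrier_mat m m" using V by auto
  let ?F = "four_block_mat (1\<^sub>m 1) (0\<^sub>m 1 m) (0\<^sub>m m 1) V"
  have F: "?F \<in> carrier_mat (1 + m) (1 + m)" by (intro four_block_carrier_mat) auto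
  have "adj ?F = four_block_mat (1\<^sub>m 1) (0\<^sub>m 1 m) (0\<^sub>m m 1) (adj V)"
    using carrier_matD[OF c] by (intro eq_matI) auto
  then have "adj ?F * ?F = four_block_mat (1\<^sub>m 1) (0\<^sub>m 1 m) (0\<^sub>m m 1) (1\<^sub>m m)"
    by (simp add: block_diag_mult[simplified] unitary_left[OF V])
  then show ?thesis using F by (simp add: unitary_def four_block_one_mat[of 1, simplified])
qed

text \<open>Induction on the dimension: in an orthonormal basis starting with an eigenvector the
  first column, hence by Hermiticity also the first row, is the eigenvalue followed by zeros, and
  the remaining block is again Hermitian.\<close>

theorem hermitian_spectral:
  assumes "A \<in> carrier_mat n n" "adj A = A"
  obtains U d where "unitary n U" "A = sform n U d"
proof -
  have "\<exists>U d. unitary n U \<and> A = sform n U d" using assms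
  proof (induction n arbitrary: A)
    case 0
    then have "unitary 0 (1\<^sub>m 0) \<and> A = sform 0 (1\<^sub>m 0) (\<lambda>_. 0)"
      by (auto simp: unitary_def sform_def)
    then show ?case by blast
  next
    case (Suc m)
    note A = Suc.prems(1) and herm = Suc.prems(2)
    let ?n = "Suc m"
    note a = square_assoc[of _ ?n]
    obtain e where "e \<in> spectrum A" using spectrum_non_empty[OF A] by auto
    then obtain v where "eigenvector A v e" by (auto simp: spectrum_def eigenvalue_def)
    then have v: "v \<in> carrier_vec ?n" "v \<noteq> 0\<^sub>v ?n" "A *\<^sub>v v = e \<cdot>\<^sub>v v"
      using A by (auto simp: eigenvector_def)
    obtain U c where U: "unitary ?n U" and c: "c \<noteq> 0" and col: "col U 0 = c \<cdot>\<^sub>v v"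
      using unitary_with_first_column[OF v(1,2)] .
    have Uc [simp]: "U \<in> carrier_mat ?n ?n" using U by auto
    have Acol: "A *\<^sub>v col U 0 = e \<cdot>\<^sub>v col U 0"
      unfolding col using v A by (simp add: mult_mat_vec smult_smult_assoc mult.commute)
    define B where "B = adj U * A * U"
    have B: "B \<in> carrier_mat ?n ?n" unfolding B_def using A by (auto intro!: mult_carrier_mat[of _ ?n ?n])
    have hB: "adj B = B" unfolding B_def using A herm by (simp add: adj_mult[of _ ?n ?n _ ?n] a)
    have B0: "B $$ (i,0) = (if i = 0 then e else 0)" if i: "i < ?n" for i
    proof -
      have "col B 0 = adj U *\<^sub>v (A *\<^sub>v col U 0)"
        unfolding B_def using A by (simp add: a col_mult2[of _ ?n ?n _ ?n])
      also have "\<dots> = e \<cdot>\<^sub>v (adj U *\<^sub>v col U 0)" unfolding Acol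
        by (rule mult_mat_vec[of _ ?n ?n]) (auto intro: carrier_vecI simp: carrier_matD[OF Uc])
      also have "adj U *\<^sub>v col U 0 = col (adj U * U) 0"
        by (simp add: col_mult2[of _ ?n ?n _ ?n])
      also have "\<dots> = unit_vec ?n 0" unfolding unitary_left[OF U] by simp
      finally have "col B 0 $ i = (e \<cdot>\<^sub>v unit_vec ?n 0) $ i" by simp
      then show ?thesis using i B by simp
    qed
    have sym: "B $$ (i,j) = cnj (B $$ (j,i))" if "i < ?n" "j < ?n" for i j
      using hB B that by (metis adj_index carrier_matD)
    have B0': "B $$ (0,i) = (if i = 0 then e else 0)" if i: "i < ?n" for i
    proof (cases "i = 0")
      case False
      have "B $$ (0,i) = cnj (B $$ (i,0))" by (rule sym) (use i in auto)
      then show ?thesis using B0[OF i] False by simp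
    qed (use B0[of 0] in simp)
    \<comment> \<open>A Hermitian matrix has a real diagonal; \<open>sform\<close> only admits real
      eigenvalues.\<close>
    have re: "e = complex_of_real (Re e)"
    proof -
      have "B $$ (0,0) = cnj (B $$ (0,0))" by (rule sym) auto
      then have "e = cnj e" unfolding B0[OF zero_less_Suc] by simp
      then show ?thesis by (metis Reals_cnj_iff complex_is_Real_iff of_real_Re)
    qed
    define C where "C = mat m m (\<lambda>(i,j). B $$ (Suc i, Suc j))"
    have C: "C \<in> carrier_mat m m" by (simp add: C_def)
    have hC: "adj C = C" by (rule eq_matI) (auto simp: C_def sym[symmetric])
    obtain V d where V: "unitary m V" and Cd: "C = sform m V d" using Suc.IH[OF C hC] by auto
    have Vc [simp]: "V \<in> carrier_mat m m" using V by auto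
    define F where "F = four_block_mat (1\<^sub>m 1) (0\<^sub>m 1 m) (0\<^sub>m m 1) V"
    have F: "unitary ?n F" unfolding F_def by (rule unitary_four_block[OF V])
    define d' where "d' k = (case k of 0 \<Rightarrow> Re e | Suc k \<Rightarrow> d k)" for k
    let ?D = "mat_diag ?n (\<lambda>i. complex_of_real (d' i))"
    have D: "?D = four_block_mat (mat 1 1 (\<lambda>_. e)) (0\<^sub>m 1 m) (0\<^sub>m m 1) (mat_diag m (\<lambda>i. complex_of_real (d i)))"
      by (rule eq_matI) (auto simp: mat_diag_def d'_def re[symmetric] split: nat.splits)
    have adF: "adj F = four_block_mat (1\<^sub>m 1) (0\<^sub>m 1 m) (0\<^sub>m m 1) (adj V)"
      unfolding F_def using carrier_matD[OF Vc] by (intro eq_matI) auto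
    have "B = four_block_mat (mat 1 1 (\<lambda>_. e)) (0\<^sub>m 1 m) (0\<^sub>m m 1) C"
      using B by (intro eq_matI) (auto simp: C_def B0 B0')
    also have "\<dots> = F * ?D * adj F"
      unfolding adF D unfolding F_def Cd sform_def
      by (simp add: block_diag_mult[simplified])
    finally have BF: "B = sform ?n F d'" by (simp add: sform_def)
    have "A = (U * adj U) * A * (U * adj U)" using A by (simp add: unitary_right[OF U])
    also have "\<dots> = U * B * adj U" unfolding B_def using A by (simp add: a)
    also have "\<dots> = sform ?n (U * F) d'"
      unfolding BF sform_def using F by (simp add: adj_mult[of _ ?n ?n _ ?n] a)
    finally show ?case using unitary_mult[OF U F] by blast
  qed
  then show ?thesis using that by blast
qed

section \<open>Positivity and matrix units\<close>

text \<open>This is <u, M w> = <adj M u, w>, in the coordinates used by \<open>psd\<close>.\<close>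

lemma sum_cnj_mult_mat_vec:
  assumes "M \<in> carrier_mat n n" "u \<in> carrier_vec n" "w \<in> carrier_vec n"
  shows "(\<Sum>i<n. cnj (u $ i) * (M *\<^sub>v w) $ i) = (\<Sum>k<n. cnj ((adj M *\<^sub>v u) $ k) * w $ k)"
proof -
  have "(\<Sum>i<n. cnj (u $ i) * (M *\<^sub>v w) $ i) = (\<Sum>i<n. \<Sum>k<n. cnj (u $ i) * (M $$ (i,k) * w $ k))"
    using assms by (auto simp: scalar_prod_def atLeast0LessThan sum_distrib_left intro!: sum.cong)
  also have "\<dots> = (\<Sum>k<n. \<Sum>i<n. cnj (u $ i) * (M $$ (i,k) * w $ k))" by (rule sum.swap)
  also have "\<dots> = (\<Sum>k<n. cnj ((adj M *\<^sub>v u) $ k) * w $ k)"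
    using assms by (auto simp: scalar_prod_def atLeast0LessThan sum_distrib_left sum_distrib_right ac_simps intro!: sum.cong)
  finally show ?thesis .
qed

text \<open>The quadratic form at \<open>v\<close> is the squared norm of
  \<open>adj M *\<^sub>v v\<close>.\<close>

lemma psd_mult_adj:
  assumes M: "M \<in> carrier_mat n n"
  shows "psd n (M * adj M)"
proof -
  have "0 \<le> Re (\<Sum>i<n. cnj (v $ i) * ((M * adj M) *\<^sub>v v) $ i)" if v: "v \<in> carrier_vec n" for v
  proof -
    have w: "adj M *\<^sub>v v \<in> carrier_vec n" using M v by (intro mult_mat_vec_carrier[of _ n n]) auto
    have "(M * adj M) *\<^sub>v v = M *\<^sub>v (adj M *\<^sub>v v)" using M v by (simp add: assoc_mult_mat_vec[of _ n n _ n])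
    then show ?thesis
      by (simp add: sum_cnj_mult_mat_vec[OF M v w] sum_nonneg)
  qed
  then show ?thesis using M by (simp add: psd_def adj_mult[of _ n n _ n])
qed

lemma psd_sform:
  assumes U: "unitary n U" and d: "\<And>k. k < n \<Longrightarrow> d k \<ge> 0"
  shows "psd n (sform n U d)"
proof -
  have "sform n U d = sform n U (\<lambda>k. sqrt (d k)) * adj (sform n U (\<lambda>k. sqrt (d k)))"
    unfolding adj_sform[OF U] sform_mult[OF U] using d by (intro sform_cong) simp
  then show ?thesis using psd_mult_adj[of "sform n U (\<lambda>k. sqrt (d k))" n] U by simp
qed

text \<open>Testing positivity on column \<open>k\<close> of \<open>U\<close> returns the eigenvalue
  \<open>d k\<close>.\<close>

lemma psd_sformD:
  assumes U: "unitary n U" and psd: "psd n (sform n U d)" and k: "k < n"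
  shows "d k \<ge> 0"
proof -
  have Uc [simp]: "U \<in> carrier_mat n n" using U by auto
  define D where "D = mat_diag n (\<lambda>i. complex_of_real (d i))"
  have D [simp]: "D \<in> carrier_mat n n" by (simp add: D_def)
  define v where "v = U *\<^sub>v unit_vec n k"
  have v [simp]: "v \<in> carrier_vec n" by (auto simp: v_def intro!: mult_mat_vec_carrier[of _ n n])
  have Uv: "adj U *\<^sub>v v = unit_vec n k"
    unfolding v_def using unitary_left[OF U]
    by (simp add: assoc_mult_mat_vec[of "adj U" n n U n, symmetric])
  have w: "D *\<^sub>v unit_vec n k \<in> carrier_vec n" by (auto intro!: mult_mat_vec_carrier[of _ n n])
  have "sform n U d *\<^sub>v v = U *\<^sub>v (D *\<^sub>v (adj U *\<^sub>v v))"
    unfolding sform_def D_def[symmetric]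
    by (simp add: assoc_mult_mat_vec[of _ n n _ n] mult_mat_vec_carrier[of _ n n])
  then have "(\<Sum>i<n. cnj (v $ i) * (sform n U d *\<^sub>v v) $ i)
      = (\<Sum>i<n. cnj (unit_vec n k $ i) * (D *\<^sub>v unit_vec n k) $ i)"
    using sum_cnj_mult_mat_vec[OF Uc v w] Uv by simp
  also have "\<dots> = (D *\<^sub>v unit_vec n k) $ k"
  proof -
    have "(\<Sum>i<n. cnj (unit_vec n k $ i) * (D *\<^sub>v unit_vec n k) $ i)
        = (\<Sum>i<n. if i = k then (D *\<^sub>v unit_vec n k) $ i else 0)"
      by (intro sum.cong) (auto simp: unit_vec_def)
    then show ?thesis using k by simp
  qed
  also have "\<dots> = complex_of_real (d k)"
    using k by (simp add: D_def mat_diag_def)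
  finally show ?thesis using psd v unfolding psd_def by (metis Re_complex_of_real)
qed

lemma psd_spectral:
  assumes "psd n A"
  obtains U d where "unitary n U" "A = sform n U d" "\<And>k. k < n \<Longrightarrow> d k \<ge> 0"
proof -
  obtain U d where "unitary n U" "A = sform n U d"
    using assms hermitian_spectral[of A n] unfolding psd_def by blast
  then show ?thesis using assms psd_sformD that by blast
qed

lemma psd_mtrace_nonneg:
  assumes "psd n A" shows "0 \<le> Re (mtrace A)"
  using psd_spectral[OF assms] by (metis Re_complex_of_real lessThan_iff mtrace_sform sum_nonneg)

section \<open>Matrix units, the trace pairing and linear functionals\<close>

definition munit :: "nat \<Rightarrow> nat \<Rightarrow> nat \<Rightarrow> complex mat" where
  "munit n k l = mat n n (\<lambda>(a,b). if a = k \<and> b = l then 1 else 0)"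

lemma munit_carrier [simp]: "munit n k l \<in> carrier_mat n n"
  by (simp add: munit_def)

lemma munit_mult:
  assumes "l < n" "l' < n"
  shows "munit n k l * munit n l' m = (if l = l' then munit n k m else 0\<^sub>m n n)"
proof (rule eq_matI)
  fix a b assume "a < dim_row (if l = l' then munit n k m else 0\<^sub>m n n)"
    "b < dim_col (if l = l' then munit n k m else 0\<^sub>m n n)"
  then have ab: "a < n" "b < n" by (auto simp: munit_def split: if_splits)
  have "(munit n k l * munit n l' m) $$ (a,b)
      = (\<Sum>c<n. (if a = k \<and> c = l then 1 else 0) * (if c = l' \<and> b = m then 1 else 0))"
    using ab by (simp add: munit_def scalar_prod_def atLeast0LessThan)
  also have "\<dots> = (\<Sum>c<n. if c = l then (if a = k \<and> l = l' \<and> b = m then 1 else 0) else 0)"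
    by (intro sum.cong) auto
  finally show "(munit n k l * munit n l' m) $$ (a,b) = (if l = l' then munit n k m else 0\<^sub>m n n) $$ (a,b)"
    using assms ab by (auto simp: munit_def)
qed (auto simp: munit_def)

lemma adj_munit [simp]: "adj (munit n k l) = munit n l k"
  by (rule eq_matI) (auto simp: munit_def)

lemma mtrace_mult_munit:
  assumes "S \<in> carrier_mat n n" "k < n" "l < n"
  shows "mtrace (S * munit n k l) = S $$ (l,k)"
proof -
  have "mtrace (S * munit n k l) = (\<Sum>i<n. \<Sum>c<n. if c = k then (if i = l then S $$ (i,c) else 0) else 0)"
    unfolding mtrace_mult[OF assms(1) munit_carrier] by (intro sum.cong) (auto simp: munit_def)
  then show ?thesis using assms by simp
qed

text \<open>The trace pairing is nondegenerate, since pairing with matrix units reads off every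
  entry.\<close>

lemma mat_eq_mtraceI:
  assumes "S \<in> carrier_mat n n" "T \<in> carrier_mat n n"
    and "\<And>Y. Y \<in> carrier_mat n n \<Longrightarrow> mtrace (S * Y) = mtrace (T * Y)"
  shows "S = T"
  using assms mtrace_mult_munit by (intro eq_matI) (metis carrier_matD munit_carrier)+

text \<open>Every matrix is reached from zero by filling in one entry at a time, so linear
  statements need checking on matrix units only.\<close>

lemma mat_unit_induct:
  assumes Y: "Y \<in> carrier_mat n n" and zero: "P (0\<^sub>m n n)"
    and step: "\<And>X c k l. X \<in> carrier_mat n n \<Longrightarrow> P X \<Longrightarrow> k < n \<Longrightarrow> l < n \<Longrightarrow> P (X + c \<cdot>\<^sub>m munit n k l)"
  shows "P Y"
proof -
  define R where "R S = mat n n (\<lambda>ab. if ab \<in> S then Y $$ ab else 0)" for S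
  have "P (R S)" if "finite S" "S \<subseteq> {..<n} \<times> {..<n}" for S using that
  proof (induction S)
    case empty
    have "R {} = 0\<^sub>m n n" by (rule eq_matI) (auto simp: R_def)
    then show ?case using zero by simp
  next
    case (insert x S)
    obtain k l where x: "x = (k,l)" by (cases x)
    have "R (insert x S) = R S + Y $$ x \<cdot>\<^sub>m munit n k l"
      using insert by (intro eq_matI) (auto simp: R_def x munit_def)
    then show ?case using insert step[of "R S" k l] by (auto simp: x R_def)
  qed
  from this[of "{..<n} \<times> {..<n}"] have "P (R ({..<n} \<times> {..<n}))" by simp
  moreover have "R ({..<n} \<times> {..<n}) = Y" using Y by (intro eq_matI) (auto simp: R_def)
  ultimately show ?thesis by simp
qed

lemma linear_functional_expand:
  fixes \<phi> :: "complex mat \<Rightarrow> complex"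
  assumes Y: "Y \<in> carrier_mat n n"
    and add: "\<And>X Y. X \<in> carrier_mat n n \<Longrightarrow> Y \<in> carrier_mat n n \<Longrightarrow> \<phi> (X + Y) = \<phi> X + \<phi> Y"
    and smult: "\<And>c X. X \<in> carrier_mat n n \<Longrightarrow> \<phi> (c \<cdot>\<^sub>m X) = c * \<phi> X"
  shows "\<phi> Y = (\<Sum>k<n. \<Sum>l<n. Y $$ (k,l) * \<phi> (munit n k l))"
proof (rule mat_unit_induct[OF Y])
  have "\<phi> (0\<^sub>m n n) = 0" using smult[of "0\<^sub>m n n" 0] by simp
  then show "\<phi> (0\<^sub>m n n) = (\<Sum>k<n. \<Sum>l<n. (0\<^sub>m n n) $$ (k,l) * \<phi> (munit n k l))" by simp
next
  fix X :: "complex mat" and c k l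
  assume X: "X \<in> carrier_mat n n" "k < n" "l < n"
    and IH: "\<phi> X = (\<Sum>k<n. \<Sum>l<n. X $$ (k,l) * \<phi> (munit n k l))"
  have "(\<Sum>a<n. \<Sum>b<n. (X + c \<cdot>\<^sub>m munit n k l) $$ (a,b) * \<phi> (munit n a b))
      = (\<Sum>a<n. \<Sum>b<n. X $$ (a,b) * \<phi> (munit n a b) + (if b = l then (if a = k then c * \<phi> (munit n a b) else 0) else 0))"
    using X by (intro sum.cong) (auto simp: munit_def algebra_simps)
  then show "\<phi> (X + c \<cdot>\<^sub>m munit n k l)
      = (\<Sum>a<n. \<Sum>b<n. (X + c \<cdot>\<^sub>m munit n k l) $$ (a,b) * \<phi> (munit n a b))"
    using X by (simp add: sum.distrib add smult IH)
qed

text \<open>Newton's scheme: a multiple of the polynomial vanishing on the old nodes corrects the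
  value at the new one. It serves to replace a function on a finite spectrum by a polynomial, under
  which a unital algebra is closed.\<close>

lemma real_interpolation:
  fixes f :: "real \<Rightarrow> real"
  assumes "finite S"
  shows "\<exists>p. \<forall>x\<in>S. poly p x = f x"
  using assms
proof (induction S)
  case (insert x S)
  then obtain p where p: "\<forall>y\<in>S. poly p y = f y" by auto
  define q where "q = (\<Prod>b\<in>S. [:-b, 1:])"
  have "poly q x \<noteq> 0" using insert by (auto simp: q_def poly_prod)
  moreover have "poly q y = 0" if "y \<in> S" for y using insert that by (auto simp: q_def poly_prod)
  ultimately have "\<forall>y\<in>insert x S. poly (p + smult ((f x - poly p x) / poly q x) q) y = f y"
    using p by auto
  then show ?case by blast
qed auto

section \<open>Conditional expectations\<close>

locale conditional_expectation =
  fixes n :: nat and N :: "complex mat set" and E :: "complex mat \<Rightarrow> complex mat"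
  assumes star: "star_subalgebra n N" and ce: "cond_exp n N E"
begin

lemma N_carrier [simp]: "A \<in> N \<Longrightarrow> A \<in> carrier_mat n n"
  and N_add [simp]: "A \<in> N \<Longrightarrow> B \<in> N \<Longrightarrow> A + B \<in> N"
  and N_mult [simp]: "A \<in> N \<Longrightarrow> B \<in> N \<Longrightarrow> A * B \<in> N"
  and N_smult [simp]: "A \<in> N \<Longrightarrow> c \<cdot>\<^sub>m A \<in> N"
  and N_adj [simp]: "A \<in> N \<Longrightarrow> adj A \<in> N"
  and N_zero [simp]: "0\<^sub>m n n \<in> N"
  using star by (auto simp: star_subalgebra_def)

lemma E_in_N [simp]: "X \<in> carrier_mat n n \<Longrightarrow> E X \<in> N"
  and E_add: "X \<in> carrier_mat n n \<Longrightarrow> Y \<in> carrier_mat n n \<Longrightarrow> E (X + Y) = E X + E Y"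
  and E_smult: "X \<in> carrier_mat n n \<Longrightarrow> E (c \<cdot>\<^sub>m X) = c \<cdot>\<^sub>m E X"
  and E_one [simp]: "E (1\<^sub>m n) = 1\<^sub>m n"
  and E_N: "A \<in> N \<Longrightarrow> E A = A"
  using ce by (auto simp: cond_exp_def)

lemma E_carrier [simp]: "X \<in> carrier_mat n n \<Longrightarrow> E X \<in> carrier_mat n n"
  by simp

text \<open>Unitality of \<open>N\<close> comes from \<open>E\<close>: the identity is its own
  image.\<close>

lemma N_one [simp]: "1\<^sub>m n \<in> N"
  using E_in_N[of "1\<^sub>m n"] by simp

lemma N_minus [simp]: "A \<in> N \<Longrightarrow> B \<in> N \<Longrightarrow> A - B \<in> N"
proof -
  assume a: "A \<in> N" "B \<in> N"
  have "A - B = A + (-1) \<cdot>\<^sub>m B" using N_carrier[OF a(1)] N_carrier[OF a(2)] by (intro eq_matI) auto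
  then show ?thesis using a by simp
qed

lemma E_minus:
  assumes "X \<in> carrier_mat n n" "Y \<in> carrier_mat n n"
  shows "E (X - Y) = E X - E Y"
proof -
  have "X - Y = X + (-1) \<cdot>\<^sub>m Y" "E X - E Y = E X + (-1) \<cdot>\<^sub>m E Y"
    using assms E_carrier[OF assms(1)] E_carrier[OF assms(2)] by (auto intro!: eq_matI)
  then show ?thesis using assms by (simp add: E_add E_smult)
qed

lemma E_left: "A \<in> N \<Longrightarrow> X \<in> carrier_mat n n \<Longrightarrow> E (A * X) = A * E X"
proof -
  assume a: "A \<in> N" "X \<in> carrier_mat n n"
  then have "E (A * X * 1\<^sub>m n) = A * E X * 1\<^sub>m n" using ce N_one unfolding cond_exp_def by blast
  then show ?thesis using a by simp
qed

lemma E_right: "A \<in> N \<Longrightarrow> X \<in> carrier_mat n n \<Longrightarrow> E (X * A) = E X * A"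
proof -
  assume a: "A \<in> N" "X \<in> carrier_mat n n"
  then have "E (1\<^sub>m n * X * A) = 1\<^sub>m n * E X * A" using ce N_one unfolding cond_exp_def by blast
  then show ?thesis using a by simp
qed

text \<open>Complete positivity for a single block, \<open>k = 1\<close>.\<close>

lemma E_psd:
  assumes "psd n X" shows "psd n (E X)"
proof -
  have [simp]: "block_mat 1 n (\<lambda>i j. Y) = Y" if "Y \<in> carrier_mat n n" for Y
    using that by (intro eq_matI) (auto simp: block_mat_def)
  have X: "X \<in> carrier_mat n n" using assms by (simp add: psd_def)
  have "psd (1*n) (block_mat 1 n (\<lambda>i j. X)) \<longrightarrow> psd (1*n) (block_mat 1 n (\<lambda>i j. E X))"
    using ce X unfolding cond_exp_def completely_positive_def
    by (elim conjE allE[of _ 1] allE[of _ "\<lambda>i j. X"]) auto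
  then show ?thesis using assms X by (simp del: One_nat_def)
qed

text \<open>Positivity suffices because \<open>4Y = (Y + 1)\<^sup>2 - (Y - 1)\<^sup>2\<close>.\<close>
lemma E_hermitian:
  assumes Y: "Y \<in> carrier_mat n n" and h: "adj Y = Y"
  shows "adj (E Y) = E Y"
proof -
  have sq: "adj (E (Z * Z)) = E (Z * Z)" if "Z \<in> carrier_mat n n" "adj Z = Z" for Z
    using E_psd[of "Z * Z"] psd_mult_adj[OF that(1)] that(2) by (simp add: psd_def)
  let ?p = "Y + 1\<^sub>m n" and ?m = "Y - 1\<^sub>m n"
  have pm: "?p \<in> carrier_mat n n" "?m \<in> carrier_mat n n" using Y by auto
  have h': "adj ?p = ?p" "adj ?m = ?m" using Y h by (simp_all add: adj_add[of _ n n] adj_minus[of _ n n])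
  have "Y = (1/4) \<cdot>\<^sub>m (?p * ?p - ?m * ?m)"
  proof -
    have "?p * ?p - ?m * ?m = (Y * Y + Y + (Y + 1\<^sub>m n)) - (Y * Y - Y - (Y - 1\<^sub>m n))"
      using Y by (simp add: square_distrib[of _ n])
    also have "\<dots> = 4 \<cdot>\<^sub>m Y" using Y by (intro eq_matI) auto
    finally show ?thesis using Y by (intro eq_matI) auto
  qed
  then have "E Y = (1/4) \<cdot>\<^sub>m (E (?p * ?p) - E (?m * ?m))"
    using pm by (metis E_minus E_smult minus_carrier_mat square_mult_carrier)
  then show ?thesis using sq[OF pm(1) h'(1)] sq[OF pm(2) h'(2)] pm
    by (simp add: adj_smult adj_minus[of _ n n])
qed

text \<open>Apply \<open>E_hermitian\<close> to Y + adj Y and i (Y - adj Y), which are both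
  Hermitian, and recombine by complex linearity.\<close>

lemma E_adj:
  assumes Y: "Y \<in> carrier_mat n n"
  shows "E (adj Y) = adj (E Y)"
proof -
  let ?H = "Y + adj Y" and ?K = "\<i> \<cdot>\<^sub>m (Y - adj Y)"
  have c: "?H \<in> carrier_mat n n" "?K \<in> carrier_mat n n" using Y by auto
  have h: "adj ?H = ?H" "adj ?K = ?K" using Y
    by (auto intro!: eq_matI simp: algebra_simps)
  have "Y = (1/2) \<cdot>\<^sub>m ?H + (-\<i>/2) \<cdot>\<^sub>m ?K" "adj Y = (1/2) \<cdot>\<^sub>m ?H + (\<i>/2) \<cdot>\<^sub>m ?K"
    using Y by (auto intro!: eq_matI simp: algebra_simps)
  then have EY: "E Y = (1/2) \<cdot>\<^sub>m E ?H + (-\<i>/2) \<cdot>\<^sub>m E ?K"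
    and "E (adj Y) = (1/2) \<cdot>\<^sub>m E ?H + (\<i>/2) \<cdot>\<^sub>m E ?K"
    using c by (metis E_add E_smult smult_carrier_mat)+
  then show ?thesis unfolding EY using c E_hermitian[OF c(1) h(1)] E_hermitian[OF c(2) h(2)]
    by (simp add: adj_add[of _ n n] adj_smult)
qed

section \<open>The state \<open>sig\<close> and its commutation with the algebra\<close>

definition sig :: "complex mat" where "sig = sigma_tr n E"

text \<open>The predual is a definite description, so existence and uniqueness are both due: the
  functional \<open>\<phi>\<close> is represented by the matrix of its values on matrix units, and
  the trace pairing is nondegenerate.\<close>

lemma sig_carrier [simp]: "sig \<in> carrier_mat n n"
  and sig_trace: "Y \<in> carrier_mat n n \<Longrightarrow> mtrace (sig * Y) = complex_of_real (1 / real n) * mtrace (E Y)"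
proof -
  let ?X = "complex_of_real (1 / real n) \<cdot>\<^sub>m 1\<^sub>m n"
  define \<phi> where "\<phi> Y = mtrace (?X * E Y)" for Y
  have \<phi>: "\<phi> Y = complex_of_real (1 / real n) * mtrace (E Y)" if "Y \<in> carrier_mat n n" for Y
    using that unfolding \<phi>_def by (simp add: square_smult[of _ n] mtrace_smult[of _ n])
  \<comment> \<open>The indices are exchanged because tracing against \<open>munit n b a\<close>
    extracts the entry \<open>(a,b)\<close>.\<close>
  define S where "S = mat n n (\<lambda>(a,b). \<phi> (munit n b a))"
  have S: "S \<in> carrier_mat n n" by (simp add: S_def)
  have St: "mtrace (S * Y) = \<phi> Y" if Y: "Y \<in> carrier_mat n n" for Y
  proof -
    have "\<phi> Y = (\<Sum>k<n. \<Sum>l<n. Y $$ (k,l) * \<phi> (munit n k l))"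
      by (rule linear_functional_expand[OF Y])
        (simp_all add: \<phi> E_add E_smult mtrace_add[of _ n] mtrace_smult[of _ n] algebra_simps)
    also have "\<dots> = mtrace (S * Y)"
      unfolding mtrace_mult[OF S Y] by (subst sum.swap) (auto simp: S_def mult.commute intro!: sum.cong)
    finally show ?thesis by simp
  qed
  have "sig = S" unfolding sig_def sigma_tr_def predual_def
  proof (rule the_equality)
    show "S \<in> carrier_mat n n \<and> (\<forall>Y\<in>carrier_mat n n. mtrace (S * Y) = mtrace (?X * E Y))"
      using S St by (simp add: \<phi>_def)
  next
    fix T assume "T \<in> carrier_mat n n \<and> (\<forall>Y\<in>carrier_mat n n. mtrace (T * Y) = mtrace (?X * E Y))"
    then show "T = S" using St S by (intro mat_eq_mtraceI[of _ n]) (auto simp: \<phi>_def)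
  qed
  then show "sig \<in> carrier_mat n n"
    and "Y \<in> carrier_mat n n \<Longrightarrow> mtrace (sig * Y) = complex_of_real (1 / real n) * mtrace (E Y)"
    using S St \<phi> by auto
qed

text \<open>This is \<open>E_adj\<close> read through the trace pairing.\<close>

lemma sig_hermitian: "adj sig = sig"
proof (rule mat_eq_mtraceI)
  fix Y :: "complex mat" assume Y: "Y \<in> carrier_mat n n"
  have "mtrace (adj sig * Y) = cnj (mtrace (adj Y * sig))"
    using Y by (simp add: mtrace_adj[of _ n, symmetric] adj_mult[of _ n n _ n])
  also have "\<dots> = cnj (mtrace (sig * adj Y))" using Y by (simp add: mtrace_commute[of sig n])
  also have "\<dots> = mtrace (sig * Y)" using Y by (simp add: sig_trace E_adj mtrace_adj[of _ n])
  finally show "mtrace (adj sig * Y) = mtrace (sig * Y)" .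
qed auto

text \<open>By the bimodule property Tr (sig A Y) and Tr (sig Y A) are Tr (A E Y) / n and Tr (E Y A)
  / n, which agree by cyclicity of the trace.\<close>

lemma sig_commute:
  assumes A: "A \<in> N" shows "sig * A = A * sig"
proof (rule mat_eq_mtraceI)
  fix Y :: "complex mat" assume Y: "Y \<in> carrier_mat n n"
  note c = N_carrier[OF A] Y
  have "mtrace (sig * A * Y) = mtrace (sig * (A * Y))" using c by (simp add: square_assoc[of _ n])
  also have "\<dots> = mtrace (sig * (Y * A))"
    using c A by (simp add: sig_trace E_left E_right mtrace_commute[of A n])
  also have "\<dots> = mtrace (A * (sig * Y))" using c
    by (subst mtrace_commute[of A n]) (auto simp: square_assoc[of _ n])
  finally show "mtrace (sig * A * Y) = mtrace (A * sig * Y)" using c by (simp add: square_assoc[of _ n])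
qed (use A in auto)

text \<open>On the finite spectrum \<open>f\<close> agrees with a polynomial, and \<open>N\<close>
  is a unital algebra.\<close>

lemma sform_fun_in_N:
  assumes U: "unitary n U" and N: "sform n U d \<in> N"
  shows "sform n U (\<lambda>i. f (d i)) \<in> N"
proof -
  obtain p where p: "\<forall>x\<in>d ` {..<n}. poly p x = f x" using real_interpolation[of "d ` {..<n}" f] by auto
  have "sform n U (\<lambda>i. poly p (d i)) \<in> N"
  proof (induction p)
    case 0
    then show ?case using sform_const[OF U, of 0] by simp
  next
    case (pCons a p)
    have "sform n U (\<lambda>i. poly (pCons a p) (d i))
        = sform n U (\<lambda>i. a) + sform n U d * sform n U (\<lambda>i. poly p (d i))"
      by (simp add: sform_mult[OF U] sform_add[OF U])
    then show ?case using pCons N by (simp add: sform_const[OF U])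
  qed
  also have "sform n U (\<lambda>i. poly p (d i)) = sform n U (\<lambda>i. f (d i))"
    using p by (intro sform_cong) auto
  finally show ?thesis .
qed

end

section \<open>Full rank of the state and faithfulness\<close>

locale faithful_conditional_expectation = conditional_expectation +
  assumes det_sig: "det (sigma_tr n E) \<noteq> 0"
begin

text \<open>The eigenvalue is Tr (sig q) with q the projection onto column \<open>k\<close> of
  \<open>U\<close>, hence nonnegative because \<open>E\<close> is positive; the determinant
  hypothesis excludes zero.\<close>

lemma sig_pos:
  assumes U: "unitary n U" and s: "sig = sform n U s" and k: "k < n"
  shows "s k > 0"
proof -
  define q where "q i = (if i = k then 1 else 0::real)" for i
  have "complex_of_real (s k) = mtrace (sig * sform n U q)"
    unfolding s sform_mult[OF U] mtrace_sform[OF U] using k by (simp add: q_def if_distrib[of "\<lambda>x. _ * x"] if_distrib[of complex_of_real] cong: if_cong)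
  also have "\<dots> = complex_of_real (1 / real n) * mtrace (E (sform n U q))"
    using U by (simp add: sig_trace)
  finally have "s k = (1 / real n) * Re (mtrace (E (sform n U q)))"
    by (metis Re_complex_of_real Im_complex_of_real mult_zero_left diff_zero times_complex.sel(1))
  moreover have "psd n (E (sform n U q))" by (intro E_psd psd_sform U) (simp add: q_def)
  ultimately have "s k \<ge> 0" using psd_mtrace_nonneg by simp
  moreover have "s k \<noteq> 0"
  proof -
    have [simp]: "U \<in> carrier_mat n n" using U by auto
    let ?D = "mat_diag n (\<lambda>i. complex_of_real (s i))"
    have "det sig = det U * det ?D * det (adj U)"
      unfolding s sform_def by (simp add: det_mult[of _ n])
    then have "det ?D \<noteq> 0" using det_sig by (auto simp: sig_def)
    moreover have "det ?D = prod_list (diag_mat ?D)"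
      by (rule det_upper_triangular[of _ n]) (auto simp: mat_diag_def)
    ultimately have "?D $$ (k,k) \<noteq> 0" using k by (auto simp: diag_mat_def prod_list_zero_iff)
    then show ?thesis using k by (simp add: mat_diag_def)
  qed
  ultimately show ?thesis by simp
qed

text \<open>With h = sig^(1/2) the trace is n times the squared Hilbert-Schmidt norm of
  \<open>Q * h\<close>, and \<open>h\<close> is invertible.\<close>

lemma E_faithful:
  assumes Q: "Q \<in> carrier_mat n n" "Q \<noteq> 0\<^sub>m n n"
  shows "Re (mtrace (E (adj Q * Q))) > 0"
proof -
  obtain U s where U: "unitary n U" and s: "sig = sform n U s"
    using hermitian_spectral[OF sig_carrier sig_hermitian] .
  define h where "h = sform n U (\<lambda>k. sqrt (s k))"
  have h: "h \<in> carrier_mat n n" "adj h = h" using U by (auto simp: h_def)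
  have hh: "h * h = sig" unfolding h_def s sform_mult[OF U] 
    by (intro sform_cong) (simp add: less_imp_le sig_pos[OF U s])
  define h' where "h' = sform n U (\<lambda>k. inverse (sqrt (s k)))"
  have h': "h' \<in> carrier_mat n n" using U by (auto simp: h'_def)
  have "h * h' = sform n U (\<lambda>k. 1)" unfolding h_def h'_def sform_mult[OF U]
    by (intro sform_cong) (use sig_pos[OF U s] in fastforce)
  then have hh': "h * h' = 1\<^sub>m n" using sform_const[OF U, of 1] by simp
  have Qh: "Q * h \<in> carrier_mat n n" using Q h by simp
  have "Q * h \<noteq> 0\<^sub>m n n"
  proof
    assume "Q * h = 0\<^sub>m n n"
    then have "Q * (h * h') = 0\<^sub>m n n" using Q h h' by (simp add: square_assoc[of _ n, symmetric])
    then show False using Q hh' by simp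
  qed
  then obtain a b where ab: "a < n" "b < n" "(Q * h) $$ (a,b) \<noteq> 0"
    using Qh by (metis carrier_matD eq_matI index_zero_mat)
  have "mtrace (sig * (adj Q * Q)) = mtrace (h * (h * (adj Q * Q)))"
    using Q h by (simp add: hh[symmetric] square_assoc[of _ n])
  also have "\<dots> = mtrace (adj (Q * h) * (Q * h))"
    using Q h by (subst mtrace_commute[of h n]) (auto simp: adj_mult[of _ n n _ n] square_assoc[of _ n])
  also have "\<dots> = complex_of_real (\<Sum>i<n. \<Sum>k<n. (cmod ((Q * h) $$ (k,i)))\<^sup>2)"
    by (rule mtrace_adj_mult_self[OF Qh])
  finally have eq: "complex_of_real (1 / real n) * mtrace (E (adj Q * Q)) = \<dots>"
    using Q by (simp add: sig_trace)
  have "0 < (\<Sum>i<n. \<Sum>k<n. (cmod ((Q * h) $$ (k,i)))\<^sup>2)"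
    using ab by (intro sum_pos2[of _ b] sum_pos2[of _ a] sum_nonneg) auto
  moreover have "(1 / real n) * Re (mtrace (E (adj Q * Q))) = (\<Sum>i<n. \<Sum>k<n. (cmod ((Q * h) $$ (k,i)))\<^sup>2)"
    using arg_cong[OF eq, of Re] by simp
  ultimately have "0 < (1 / real n) * Re (mtrace (E (adj Q * Q)))" by simp
  then show ?thesis using ab by (simp add: zero_less_divide_iff)
qed

end

section \<open>Matrix units of an orthonormal basis, and the choice of the basis\<close>

definition eunit :: "nat \<Rightarrow> complex mat \<Rightarrow> nat \<Rightarrow> nat \<Rightarrow> complex mat" where
  "eunit n U k l = U * munit n k l * adj U"

lemma eunit_carrier [simp]: "unitary n U \<Longrightarrow> eunit n U k l \<in> carrier_mat n n"
  by (simp add: eunit_def)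

lemma eunit_mult:
  assumes "unitary n U" "l < n" "l' < n"
  shows "eunit n U k l * eunit n U l' m = (if l = l' then eunit n U k m else 0\<^sub>m n n)"
  unfolding eunit_def using assms
  by (simp add: conj_unitary_mult munit_mult right_mult_zero_mat[of _ n n] left_mult_zero_mat[of _ n n])

lemma adj_eunit: "unitary n U \<Longrightarrow> adj (eunit n U k l) = eunit n U l k"
  unfolding eunit_def by (simp add: adj_mult[of _ n n _ n] square_assoc[of _ n])

lemma sform_mult_eunit:
  assumes U: "unitary n U" and k: "k < n"
  shows "sform n U d * eunit n U k l = complex_of_real (d k) \<cdot>\<^sub>m eunit n U k l"
proof -
  have "mat_diag n (\<lambda>i. complex_of_real (d i)) * munit n k l = complex_of_real (d k) \<cdot>\<^sub>m munit n k l"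
    by (simp add: mat_diag_mult_left[of _ n n]) (auto simp: munit_def intro!: eq_matI)
  then show ?thesis unfolding sform_def eunit_def using U
    by (simp add: conj_unitary_mult square_smult[of _ n])
qed

lemma eunit_mult_sform:
  assumes U: "unitary n U" and l: "l < n"
  shows "eunit n U k l * sform n U d = complex_of_real (d l) \<cdot>\<^sub>m eunit n U k l"
proof -
  have "munit n k l * mat_diag n (\<lambda>i. complex_of_real (d i)) = complex_of_real (d l) \<cdot>\<^sub>m munit n k l"
    by (simp add: mat_diag_mult_right[of _ n n]) (auto simp: munit_def intro!: eq_matI)
  then show ?thesis unfolding sform_def eunit_def using U
    by (simp add: conj_unitary_mult square_smult[of _ n])
qed

locale proper_conditional_expectation = faithful_conditional_expectation +
  assumes not_scalar: "N \<noteq> {c \<cdot>\<^sub>m 1\<^sub>m n | c. True}" and not_full: "N \<noteq> carrier_mat n n"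
begin

text \<open>Each element of \<open>N\<close> is a combination of two Hermitian elements of
  \<open>N\<close>; if both were scalar, so would it be.\<close>

lemma hermitian_nonscalar:
  obtains A where "A \<in> N" "adj A = A" "\<And>c. A \<noteq> c \<cdot>\<^sub>m 1\<^sub>m n"
proof -
  have "{c \<cdot>\<^sub>m 1\<^sub>m n | c. True} \<subseteq> N" by auto
  then obtain X where X: "X \<in> N" "\<And>c. X \<noteq> c \<cdot>\<^sub>m 1\<^sub>m n" using not_scalar by blast
  have Xc: "X \<in> carrier_mat n n" using X by simp
  let ?H = "X + adj X" and ?K = "\<i> \<cdot>\<^sub>m (X - adj X)"
  have N: "?H \<in> N" "?K \<in> N" using X by auto
  have h: "adj ?H = ?H" "adj ?K = ?K" using Xc by (auto intro!: eq_matI simp: algebra_simps)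
  have split: "X = (1/2) \<cdot>\<^sub>m ?H + (-\<i>/2) \<cdot>\<^sub>m ?K"
    using Xc by (auto intro!: eq_matI simp: algebra_simps)
  have "\<not> (\<exists>a b. ?H = a \<cdot>\<^sub>m 1\<^sub>m n \<and> ?K = b \<cdot>\<^sub>m 1\<^sub>m n)"
  proof
    assume "\<exists>a b. ?H = a \<cdot>\<^sub>m 1\<^sub>m n \<and> ?K = b \<cdot>\<^sub>m 1\<^sub>m n"
    then obtain a b where ab: "?H = a \<cdot>\<^sub>m 1\<^sub>m n" "?K = b \<cdot>\<^sub>m 1\<^sub>m n" by auto
    have "X = (a/2 - \<i>*b/2) \<cdot>\<^sub>m 1\<^sub>m n"
      using split unfolding ab by (auto intro!: eq_matI simp: algebra_simps)
    then show False using X by blast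
  qed
  then show ?thesis using that N h by blast
qed

text \<open>The Hermitian matrix \<open>\<sigma>(2P - 1)\<close> has modulus \<open>\<sigma>\<close> and sign \<open>2P - 1\<close>, so any basis that
  diagonalises it diagonalises both \<open>\<sigma>\<close> and \<open>P\<close>.\<close>
lemma diagonalising_frame:
  obtains U s p where "unitary n U" "sig = sform n U s"
    "sform n U (\<lambda>k. if k \<in> p then 1 else 0) \<in> N" "\<exists>i<n. i \<in> p" "\<exists>j<n. j \<notin> p"
proof -
  obtain A where A: "A \<in> N" "adj A = A" "\<And>c. A \<noteq> c \<cdot>\<^sub>m 1\<^sub>m n"
    using hermitian_nonscalar by metis
  obtain V a where V: "unitary n V" and Aa: "A = sform n V a"
    using hermitian_spectral[OF N_carrier[OF A(1)] A(2)] .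
  obtain k0 k1 where k: "k0 < n" "k1 < n" "a k0 \<noteq> a k1"
  proof -
    have "\<exists>k0<n. \<exists>k1<n. a k0 \<noteq> a k1"
    proof (rule ccontr)
      assume neg: "\<not> (\<exists>k0<n. \<exists>k1<n. a k0 \<noteq> a k1)"
      have "a i = a 0" if "i < n" for i
      proof -
        have "0 < n" using that by simp
        then show ?thesis using neg that by blast
      qed
      then have "sform n V a = sform n V (\<lambda>_. a 0)" by (rule sform_cong)
      then show False using A(3)[of "complex_of_real (a 0)"] Aa sform_const[OF V, of "a 0"] by simp
    qed
    then show ?thesis using that by blast
  qed
  \<comment> \<open>\<open>P\<close> is the spectral projection of \<open>A\<close> for the
    eigenvalue \<open>a k0\<close>, and \<open>J = 2P - 1\<close> is the corresponding
    symmetry.\<close>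
  define P where "P = sform n V (\<lambda>k. if a k = a k0 then 1 else 0)"
  define J where "J = sform n V (\<lambda>k. if a k = a k0 then 1 else -1)"
  have P: "P \<in> N" and J: "J \<in> N" unfolding P_def J_def
    using sform_fun_in_N[OF V A(1)[unfolded Aa], of "\<lambda>x. if x = a k0 then 1 else 0"]
      sform_fun_in_N[OF V A(1)[unfolded Aa], of "\<lambda>x. if x = a k0 then 1 else -1"] by auto
  have Jc: "J \<in> carrier_mat n n" using J by simp
  have PJ: "P = complex_of_real (1/2) \<cdot>\<^sub>m (J + sform n V (\<lambda>k. 1))"
    unfolding P_def J_def sform_add[OF V] sform_smult[OF V] by (intro sform_cong) auto
  have JJ: "J * J = 1\<^sub>m n"
  proof -
    have "J * J = sform n V (\<lambda>k. 1)" unfolding J_def sform_mult[OF V] by (intro sform_cong) auto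
    then show ?thesis using sform_const[OF V, of 1] by simp
  qed
  have hJ: "adj J = J" unfolding J_def using V by simp
  have com: "sig * J = J * sig" by (rule sig_commute[OF J])
  define T where "T = sig * J"
  have T: "T \<in> carrier_mat n n" using Jc by (simp add: T_def)
  have "adj T = T" unfolding T_def using Jc by (simp add: adj_mult[of _ n n _ n] hJ sig_hermitian com)
  then obtain U d where U: "unitary n U" and Td: "T = sform n U d" using hermitian_spectral[OF T] by blast
  have TT: "T * T = sig * sig"
  proof -
    have "T * T = sig * (J * sig) * J" unfolding T_def using Jc by (simp add: square_assoc[of _ n])
    also have "\<dots> = sig * sig * (J * J)" unfolding com[symmetric] using Jc by (simp add: square_assoc[of _ n])
    finally show ?thesis by (simp add: JJ)
  qed
  obtain W s0 where W: "unitary n W" and s0: "sig = sform n W s0"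
    using hermitian_spectral[OF sig_carrier sig_hermitian] .
  \<comment> \<open>Equal squares have equal positive square roots, and \<open>sig\<close> is
    positive; so the moduli of the eigenvalues of \<open>T\<close> are the eigenvalues of
    \<open>sig\<close> in the basis \<open>U\<close>.\<close>
  have "sform n U (\<lambda>i. d i * d i) = sform n W (\<lambda>i. s0 i * s0 i)"
    using TT unfolding Td s0 sform_mult[OF U] sform_mult[OF W] .
  from sform_unique[OF U W this, of sqrt] have "sform n U (\<lambda>i. \<bar>d i\<bar>) = sform n W (\<lambda>i. \<bar>s0 i\<bar>)" by simp
  also have "\<dots> = sig" unfolding s0 using sig_pos[OF W s0] by (intro sform_cong) (auto simp: less_imp_le)
  finally have s: "sig = sform n U (\<lambda>i. \<bar>d i\<bar>)" by simp
  have d0: "d i \<noteq> 0" if "i < n" for i using sig_pos[OF U s that] by simp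
  \<comment> \<open>\<open>J\<close> is recovered as the sign of \<open>T\<close>, that is |T|^(-1)
    T, and so is diagonal in the same basis.\<close>
  have "J = sform n U (\<lambda>i. inverse \<bar>d i\<bar>) * sig * J"
  proof -
    have "sform n U (\<lambda>i. inverse \<bar>d i\<bar>) * sig = sform n U (\<lambda>i. 1)"
      unfolding s sform_mult[OF U] using d0 by (intro sform_cong) auto
    then show ?thesis using sform_const[OF U, of 1] Jc by simp
  qed
  also have "\<dots> = sform n U (\<lambda>i. inverse \<bar>d i\<bar>) * T" unfolding T_def using Jc U by (simp add: square_assoc[of _ n])
  also have "\<dots> = sform n U (\<lambda>i. inverse \<bar>d i\<bar> * d i)" unfolding Td sform_mult[OF U] ..
  finally have JU: "J = sform n U (\<lambda>i. inverse \<bar>d i\<bar> * d i)" .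
  define p where "p = {i. d i > 0}"
  have PU: "P = sform n U (\<lambda>k. if k \<in> p then 1 else 0)"
  proof -
    have "P = complex_of_real (1/2) \<cdot>\<^sub>m (J + sform n U (\<lambda>k. 1))"
      unfolding PJ using sform_const[OF U, of 1] sform_const[OF V, of 1] by simp
    also have "\<dots> = sform n U (\<lambda>k. if k \<in> p then 1 else 0)"
      unfolding JU sform_add[OF U] sform_smult[OF U] using d0 by (intro sform_cong) (auto simp: p_def)
    finally show ?thesis .
  qed
  \<comment> \<open>The number of indices in \<open>p\<close> is the trace of \<open>P\<close>,
    which in the basis \<open>V\<close> counts \<open>k0\<close> but not \<open>k1\<close>; so it
    lies strictly between 0 and \<open>n\<close>.\<close>
  have "mtrace P = complex_of_real (\<Sum>k<n. if k \<in> p then 1 else 0)" unfolding PU by (rule mtrace_sform[OF U])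
  moreover have "mtrace P = complex_of_real (\<Sum>k<n. if a k = a k0 then 1 else 0)" unfolding P_def by (rule mtrace_sform[OF V])
  ultimately have tr: "(\<Sum>k<n. if k \<in> p then 1 else 0::real) = (\<Sum>k<n. if a k = a k0 then 1 else 0)"
    by (metis of_real_eq_iff)
  have "(0::real) < (\<Sum>k<n. if a k = a k0 then 1 else 0)" using k by (intro sum_pos2[of _ k0]) auto
  then have "\<exists>k\<in>{..<n}. (if k \<in> p then 1 else 0::real) > 0"
    unfolding tr[symmetric] by (metis not_le sum_nonpos)
  then have "\<exists>i<n. i \<in> p" by (auto split: if_splits)
  moreover have "(\<Sum>k<n. if a k = a k0 then 1 else 0::real) < (\<Sum>k<n. 1)"
    using k by (intro sum_strict_mono_ex1) (auto intro!: bexI[of _ k1])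
  then have "\<exists>k\<in>{..<n}. (if k \<in> p then 1 else 0::real) < 1"
    unfolding tr[symmetric] by (metis (no_types, lifting) not_le sum_mono)
  then have "\<exists>j<n. j \<notin> p" by (auto split: if_splits)
  ultimately show ?thesis using that[OF U s _] P[unfolded PU] by blast
qed

text \<open>Otherwise all units from \<open>p\<close> to its complement lie in \<open>N\<close>, and
  so do their adjoints. Products of these through an index of the other class give the units within
  a class, so \<open>N\<close> would be the full matrix algebra.\<close>

lemma off_diagonal_unit:
  assumes U: "unitary n U" and p: "\<exists>i<n. i \<in> p" "\<exists>j<n. j \<notin> p"
  obtains i j where "i < n" "j < n" "i \<in> p" "j \<notin> p" "eunit n U i j \<notin> N"
proof (rule ccontr)
  assume "\<not> thesis"
  with that have up: "eunit n U i j \<in> N" if "i < n" "j < n" "i \<in> p" "j \<notin> p" for i j using that by blast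
  have low: "eunit n U j i \<in> N" if "i < n" "j < n" "i \<in> p" "j \<notin> p" for i j
    using N_adj[OF up[OF that]] by (simp add: adj_eunit[OF U])
  obtain i0 j0 where ij: "i0 < n" "i0 \<in> p" "j0 < n" "j0 \<notin> p" using p by auto
  have all: "eunit n U k l \<in> N" if "k < n" "l < n" for k l
  proof -
    have "eunit n U k l \<in> N" if "k \<in> p" "l \<in> p"
      using N_mult[OF up[of k j0] low[of l j0]] that ij \<open>k < n\<close> \<open>l < n\<close> by (simp add: eunit_mult[OF U])
    moreover have "eunit n U k l \<in> N" if "k \<notin> p" "l \<notin> p"
      using N_mult[OF low[of i0 k] up[of i0 l]] that ij \<open>k < n\<close> \<open>l < n\<close> by (simp add: eunit_mult[OF U])
    ultimately show ?thesis using up low that by blast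
  qed
  have [simp]: "U \<in> carrier_mat n n" using U by simp
  have "X \<in> N" if X: "X \<in> carrier_mat n n" for X
  proof -
    have "adj U * X * U \<in> carrier_mat n n" using X by simp
    then have "U * (adj U * X * U) * adj U \<in> N"
    proof (rule mat_unit_induct)
      show "U * 0\<^sub>m n n * adj U \<in> N" by (simp add: right_mult_zero_mat[of _ n n] left_mult_zero_mat[of _ n n])
    next
      fix Y c k l assume "Y \<in> carrier_mat n n" "U * Y * adj U \<in> N" "k < n" "l < n"
      moreover from this have "U * (Y + c \<cdot>\<^sub>m munit n k l) * adj U = U * Y * adj U + c \<cdot>\<^sub>m eunit n U k l"
        by (simp add: eunit_def square_distrib[of _ n] square_smult[of _ n])
      ultimately show "U * (Y + c \<cdot>\<^sub>m munit n k l) * adj U \<in> N" using all by simp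
    qed
    also have "U * (adj U * X * U) * adj U = (U * adj U) * X * (U * adj U)"
      using X by (simp add: square_assoc[of _ n])
    finally show ?thesis using X by (simp add: unitary_right[OF U])
  qed
  then have "N = carrier_mat n n" by auto
  then show False using not_full by simp
qed

end

section \<open>Bounded matrix families\<close>

text \<open>Entrywise O(1), uniformly for \<open>\<epsilon>\<close> in the open unit interval: the
  form in which matrix error terms are carried.\<close>

definition bounded_family :: "nat \<Rightarrow> (real \<Rightarrow> complex mat) \<Rightarrow> bool" where
  "bounded_family n M \<longleftrightarrow> (\<exists>K. \<forall>\<epsilon>\<in>{0<..<1}. M \<epsilon> \<in> carrier_mat n n \<and>
     (\<forall>a<n. \<forall>b<n. cmod (M \<epsilon> $$ (a,b)) \<le> K))"

lemma bounded_familyI: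
  assumes "\<And>\<epsilon>. 0 < \<epsilon> \<Longrightarrow> \<epsilon> < 1 \<Longrightarrow> M \<epsilon> \<in> carrier_mat n n"
    and "\<And>\<epsilon> a b. 0 < \<epsilon> \<Longrightarrow> \<epsilon> < 1 \<Longrightarrow> a < n \<Longrightarrow> b < n \<Longrightarrow> cmod (M \<epsilon> $$ (a,b)) \<le> K"
  shows "bounded_family n M"
  unfolding bounded_family_def using assms by (intro exI[of _ K]) auto

lemma bounded_familyE:
  assumes "bounded_family n M"
  obtains K where "\<And>\<epsilon>. 0 < \<epsilon> \<Longrightarrow> \<epsilon> < 1 \<Longrightarrow> M \<epsilon> \<in> carrier_mat n n" "K \<ge> 0"
    "\<And>\<epsilon> a b. 0 < \<epsilon> \<Longrightarrow> \<epsilon> < 1 \<Longrightarrow> a < n \<Longrightarrow> b < n \<Longrightarrow> cmod (M \<epsilon> $$ (a,b)) \<le> K"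
proof -
  obtain K where K: "\<forall>\<epsilon>\<in>{0<..<1}. M \<epsilon> \<in> carrier_mat n n \<and> (\<forall>a<n. \<forall>b<n. cmod (M \<epsilon> $$ (a,b)) \<le> K)"
    using assms unfolding bounded_family_def by blast
  show ?thesis by (rule that[of "max K 0"]) (use K in \<open>auto simp: le_max_iff_disj\<close>)
qed

lemma bounded_family_carrier:
  "bounded_family n M \<Longrightarrow> 0 < \<epsilon> \<Longrightarrow> \<epsilon> < 1 \<Longrightarrow> M \<epsilon> \<in> carrier_mat n n"
  unfolding bounded_family_def by auto

lemma bounded_family_const:
  assumes "A \<in> carrier_mat n n" shows "bounded_family n (\<lambda>_. A)"
proof (rule bounded_familyI[where K = "\<Sum>a<n. \<Sum>b<n. cmod (A $$ (a,b))"])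
  fix a b assume ab: "a < n" "b < n"
  have "cmod (A $$ (a,b)) \<le> (\<Sum>b<n. cmod (A $$ (a,b)))" using ab by (intro member_le_sum) auto
  also have "\<dots> \<le> (\<Sum>a<n. \<Sum>b<n. cmod (A $$ (a,b)))"
    using ab by (intro member_le_sum[of a _ "\<lambda>a. \<Sum>b<n. cmod (A $$ (a,b))"] sum_nonneg) auto
  finally show "cmod (A $$ (a,b)) \<le> (\<Sum>a<n. \<Sum>b<n. cmod (A $$ (a,b)))" .
qed (use assms in auto)

lemma bounded_family_add:
  assumes "bounded_family n M" "bounded_family n L"
  shows "bounded_family n (\<lambda>\<epsilon>. M \<epsilon> + L \<epsilon>)"
proof -
  obtain K where K: "\<And>\<epsilon>. 0 < \<epsilon> \<Longrightarrow> \<epsilon> < 1 \<Longrightarrow> M \<epsilon> \<in> carrier_mat n n" "K \<ge> 0"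
    "\<And>\<epsilon> a b. 0 < \<epsilon> \<Longrightarrow> \<epsilon> < 1 \<Longrightarrow> a < n \<Longrightarrow> b < n \<Longrightarrow> cmod (M \<epsilon> $$ (a,b)) \<le> K"
    using bounded_familyE[OF assms(1)] by blast
  obtain H where H: "\<And>\<epsilon>. 0 < \<epsilon> \<Longrightarrow> \<epsilon> < 1 \<Longrightarrow> L \<epsilon> \<in> carrier_mat n n" "H \<ge> 0"
    "\<And>\<epsilon> a b. 0 < \<epsilon> \<Longrightarrow> \<epsilon> < 1 \<Longrightarrow> a < n \<Longrightarrow> b < n \<Longrightarrow> cmod (L \<epsilon> $$ (a,b)) \<le> H"
    using bounded_familyE[OF assms(2)] by blast
  show ?thesis
  proof (rule bounded_familyI[where K = "K + H"])
    fix \<epsilon> :: real and a b assume e: "0 < \<epsilon>" "\<epsilon> < 1" and ab: "a < n" "b < n"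
    show "cmod ((M \<epsilon> + L \<epsilon>) $$ (a,b)) \<le> K + H"
      using norm_triangle_mono[OF K(3)[OF e ab] H(3)[OF e ab]] K(1)[OF e] H(1)[OF e] ab by simp
  qed (use K H in auto)
qed

lemma bounded_family_mult:
  assumes "bounded_family n M" "bounded_family n L"
  shows "bounded_family n (\<lambda>\<epsilon>. M \<epsilon> * L \<epsilon>)"
proof -
  obtain K where K: "\<And>\<epsilon>. 0 < \<epsilon> \<Longrightarrow> \<epsilon> < 1 \<Longrightarrow> M \<epsilon> \<in> carrier_mat n n" "K \<ge> 0"
    "\<And>\<epsilon> a b. 0 < \<epsilon> \<Longrightarrow> \<epsilon> < 1 \<Longrightarrow> a < n \<Longrightarrow> b < n \<Longrightarrow> cmod (M \<epsilon> $$ (a,b)) \<le> K"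
    using bounded_familyE[OF assms(1)] by blast
  obtain H where H: "\<And>\<epsilon>. 0 < \<epsilon> \<Longrightarrow> \<epsilon> < 1 \<Longrightarrow> L \<epsilon> \<in> carrier_mat n n" "H \<ge> 0"
    "\<And>\<epsilon> a b. 0 < \<epsilon> \<Longrightarrow> \<epsilon> < 1 \<Longrightarrow> a < n \<Longrightarrow> b < n \<Longrightarrow> cmod (L \<epsilon> $$ (a,b)) \<le> H"
    using bounded_familyE[OF assms(2)] by blast
  show ?thesis
  proof (rule bounded_familyI[where K = "real n * (K * H)"])
    fix \<epsilon> :: real and a b assume e: "0 < \<epsilon>" "\<epsilon> < 1" and ab: "a < n" "b < n"
    have "(M \<epsilon> * L \<epsilon>) $$ (a,b) = (\<Sum>c<n. M \<epsilon> $$ (a,c) * L \<epsilon> $$ (c,b))"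
      using K(1)[OF e] H(1)[OF e] ab by (auto simp: scalar_prod_def atLeast0LessThan)
    also have "cmod \<dots> \<le> (\<Sum>c<n. K * H)"
      using K H e ab by (intro sum_norm_le) (auto simp: norm_mult intro!: mult_mono)
    finally show "cmod ((M \<epsilon> * L \<epsilon>) $$ (a,b)) \<le> real n * (K * H)" by simp
  qed (use K H in auto)
qed

lemma bounded_family_smult:
  assumes "bounded_family n M" and f: "\<And>\<epsilon>. 0 < \<epsilon> \<Longrightarrow> \<epsilon> < 1 \<Longrightarrow> cmod (f \<epsilon>) \<le> H"
  shows "bounded_family n (\<lambda>\<epsilon>. f \<epsilon> \<cdot>\<^sub>m M \<epsilon>)"
proof -
  obtain K where K: "\<And>\<epsilon>. 0 < \<epsilon> \<Longrightarrow> \<epsilon> < 1 \<Longrightarrow> M \<epsilon> \<in> carrier_mat n n" "K \<ge> 0"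
    "\<And>\<epsilon> a b. 0 < \<epsilon> \<Longrightarrow> \<epsilon> < 1 \<Longrightarrow> a < n \<Longrightarrow> b < n \<Longrightarrow> cmod (M \<epsilon> $$ (a,b)) \<le> K"
    using bounded_familyE[OF assms(1)] by blast
  show ?thesis
  proof (rule bounded_familyI[where K = "H * K"])
    fix \<epsilon> :: real and a b assume e: "0 < \<epsilon>" "\<epsilon> < 1" and ab: "a < n" "b < n"
    have "H \<ge> 0" using f[OF e] norm_ge_zero order_trans by blast
    then show "cmod ((f \<epsilon> \<cdot>\<^sub>m M \<epsilon>) $$ (a,b)) \<le> H * K"
      using K(1)[OF e] ab f[OF e] K(3)[OF e ab] by (auto simp: norm_mult intro!: mult_mono)
  qed (use K in auto)
qed

lemma bounded_family_minus:
  assumes "bounded_family n M" "bounded_family n L"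
  shows "bounded_family n (\<lambda>\<epsilon>. M \<epsilon> - L \<epsilon>)"
proof -
  have b: "bounded_family n (\<lambda>\<epsilon>. M \<epsilon> + (-1) \<cdot>\<^sub>m L \<epsilon>)"
    by (intro bounded_family_add bounded_family_smult[where H = 1] assms) auto
  have eq: "M \<epsilon> - L \<epsilon> = M \<epsilon> + (-1) \<cdot>\<^sub>m L \<epsilon>" if "0 < \<epsilon>" "\<epsilon> < 1" for \<epsilon>
    using bounded_family_carrier[OF assms(1) that] bounded_family_carrier[OF assms(2) that]
    by (intro eq_matI) auto
  show ?thesis using b unfolding bounded_family_def by (simp add: eq)
qed

lemma bounded_family_adj:
  assumes "bounded_family n M"
  shows "bounded_family n (\<lambda>\<epsilon>. adj (M \<epsilon>))"
proof -
  obtain K where K: "\<And>\<epsilon>. 0 < \<epsilon> \<Longrightarrow> \<epsilon> < 1 \<Longrightarrow> M \<epsilon> \<in> carrier_mat n n" "K \<ge> 0"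
    "\<And>\<epsilon> a b. 0 < \<epsilon> \<Longrightarrow> \<epsilon> < 1 \<Longrightarrow> a < n \<Longrightarrow> b < n \<Longrightarrow> cmod (M \<epsilon> $$ (a,b)) \<le> K"
    using bounded_familyE[OF assms(1)] by blast
  show ?thesis
  proof (rule bounded_familyI[where K = K])
    fix \<epsilon> :: real and a b assume e: "0 < \<epsilon>" "\<epsilon> < 1" and ab: "a < n" "b < n"
    then show "cmod (adj (M \<epsilon>) $$ (a,b)) \<le> K" using K(1)[OF e] K(3)[OF e ab(2,1)] by simp
  qed (use K in auto)
qed

lemma bounded_family_mtrace:
  assumes "bounded_family n M"
  obtains K where "\<And>\<epsilon>. 0 < \<epsilon> \<Longrightarrow> \<epsilon> < 1 \<Longrightarrow> \<bar>Re (mtrace (M \<epsilon>))\<bar> \<le> K"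
proof -
  obtain K where K: "\<And>\<epsilon>. 0 < \<epsilon> \<Longrightarrow> \<epsilon> < 1 \<Longrightarrow> M \<epsilon> \<in> carrier_mat n n" "K \<ge> 0"
    "\<And>\<epsilon> a b. 0 < \<epsilon> \<Longrightarrow> \<epsilon> < 1 \<Longrightarrow> a < n \<Longrightarrow> b < n \<Longrightarrow> cmod (M \<epsilon> $$ (a,b)) \<le> K"
    using bounded_familyE[OF assms(1)] by blast
  show ?thesis
  proof (rule that[of "real n * K"])
    fix \<epsilon> :: real assume e: "0 < \<epsilon>" "\<epsilon> < 1"
    have "mtrace (M \<epsilon>) = (\<Sum>i<n. M \<epsilon> $$ (i,i))"
      using carrier_matD[OF K(1)[OF e]] by (simp add: mtrace_def)
    also have "cmod \<dots> \<le> (\<Sum>i<n. K)" using K(3)[OF e] by (intro sum_norm_le) auto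
    finally have "cmod (mtrace (M \<epsilon>)) \<le> (\<Sum>i<n. K)" .
    then show "\<bar>Re (mtrace (M \<epsilon>))\<bar> \<le> real n * K" using abs_Re_le_cmod[of "mtrace (M \<epsilon>)"] by simp
  qed
qed

context conditional_expectation
begin

text \<open>A linear map in finite dimension is bounded: expand in matrix units, whose images do not
  depend on \<open>\<epsilon>\<close>.\<close>

lemma bounded_family_E:
  assumes "bounded_family n M"
  shows "bounded_family n (\<lambda>\<epsilon>. E (M \<epsilon>))"
proof -
  obtain K where K: "\<And>\<epsilon>. 0 < \<epsilon> \<Longrightarrow> \<epsilon> < 1 \<Longrightarrow> M \<epsilon> \<in> carrier_mat n n" "K \<ge> 0"
    "\<And>\<epsilon> a b. 0 < \<epsilon> \<Longrightarrow> \<epsilon> < 1 \<Longrightarrow> a < n \<Longrightarrow> b < n \<Longrightarrow> cmod (M \<epsilon> $$ (a,b)) \<le> K"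
    using bounded_familyE[OF assms(1)] by blast
  define H where "H = (\<Sum>k<n. \<Sum>l<n. \<Sum>a<n. \<Sum>b<n. cmod (E (munit n k l) $$ (a,b)))"
  have H: "(\<Sum>k<n. \<Sum>l<n. cmod (E (munit n k l) $$ (a,b))) \<le> H" if "a < n" "b < n" for a b
    unfolding H_def
  proof (intro sum_mono)
    fix k l
    have "cmod (E (munit n k l) $$ (a,b)) \<le> (\<Sum>b<n. cmod (E (munit n k l) $$ (a,b)))"
      using that by (intro member_le_sum) auto
    also have "\<dots> \<le> (\<Sum>a<n. \<Sum>b<n. cmod (E (munit n k l) $$ (a,b)))"
      using that by (intro member_le_sum[of a _ "\<lambda>a. \<Sum>b<n. cmod (E (munit n k l) $$ (a,b))"] sum_nonneg) auto
    finally show "cmod (E (munit n k l) $$ (a,b)) \<le> (\<Sum>a<n. \<Sum>b<n. cmod (E (munit n k l) $$ (a,b)))" .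
  qed
  show ?thesis
  proof (rule bounded_familyI[where K = "K * H"])
    fix \<epsilon> :: real and a b assume e: "0 < \<epsilon>" "\<epsilon> < 1" and ab: "a < n" "b < n"
    have "E (M \<epsilon>) $$ (a,b) = (\<Sum>k<n. \<Sum>l<n. M \<epsilon> $$ (k,l) * E (munit n k l) $$ (a,b))"
    proof (rule linear_functional_expand[OF K(1)[OF e]])
      fix X Y :: "complex mat" assume XY: "X \<in> carrier_mat n n" "Y \<in> carrier_mat n n"
      show "E (X + Y) $$ (a,b) = E X $$ (a,b) + E Y $$ (a,b)"
        using ab carrier_matD[OF E_carrier[OF XY(1)]] carrier_matD[OF E_carrier[OF XY(2)]] XY
        by (simp add: E_add)
    next
      fix c and X :: "complex mat" assume X: "X \<in> carrier_mat n n"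
      show "E (c \<cdot>\<^sub>m X) $$ (a,b) = c * E X $$ (a,b)"
        using ab carrier_matD[OF E_carrier[OF X]] X by (simp add: E_smult)
    qed
    also have "cmod \<dots> \<le> (\<Sum>k<n. \<Sum>l<n. K * cmod (E (munit n k l) $$ (a,b)))"
      using K(3)[OF e] by (intro sum_norm_le) (auto simp: norm_mult intro!: mult_right_mono)
    also have "\<dots> = K * (\<Sum>k<n. \<Sum>l<n. cmod (E (munit n k l) $$ (a,b)))"
      by (simp add: sum_distrib_left)
    also have "\<dots> \<le> K * H" using H[OF ab] K(2) by (rule mult_left_mono)
    finally show "cmod (E (M \<epsilon>) $$ (a,b)) \<le> K * H" .
  qed (use K in auto)
qed

end

section \<open>The test family\<close>

text \<open>Split g = g (1-g)^2 + g^2 (2-g). On the first part ln g is at most ln \<delta> +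
  g/\<delta>; on the second (2-g) ln g is at most g - 1. For small \<open>\<delta>\<close> the
  dominant coefficient ln \<delta> sees the eigenvalues near 0, while the factor (1-g)^2 discards
  those near 1.\<close>

lemma xlnx_le:
  fixes g \<delta> :: real
  assumes "g \<ge> 0" "\<delta> > 0"
  shows "g * ln g \<le> ln \<delta> * (g * (1 - g)\<^sup>2) + (g - g\<^sup>2)\<^sup>2 / \<delta> + g\<^sup>2 * (g - 1)"
proof (cases "g = 0")
  case False
  then have g: "g > 0" using assms by simp
  have "ln (g / \<delta>) \<le> g / \<delta> - 1" using g assms by (intro ln_le_minus_one) auto
  then have "ln g \<le> ln \<delta> + g / \<delta>" using g assms by (simp add: ln_div)
  then have "(g * (1 - g)\<^sup>2) * ln g \<le> (g * (1 - g)\<^sup>2) * (ln \<delta> + g / \<delta>)"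
    using g by (intro mult_left_mono) auto
  also have "\<dots> = ln \<delta> * (g * (1 - g)\<^sup>2) + (g - g\<^sup>2)\<^sup>2 / \<delta>"
    using assms by (simp add: field_simps power2_eq_square)
  finally have 1: "(g * (1 - g)\<^sup>2) * ln g \<le> ln \<delta> * (g * (1 - g)\<^sup>2) + (g - g\<^sup>2)\<^sup>2 / \<delta>" .
  have "(2 - g) * ln g \<le> g - 1"
  proof -
    have ln: "ln g \<le> g - 1" using g by (rule ln_le_minus_one)
    \<comment> \<open>The sign of ln g changes at 1 and that of 2 - g at 2; between these points 2 -
      g is at most 1, and below 1 it exceeds 1.\<close>
    consider "g \<ge> 2" | "1 \<le> g" "g \<le> 2" | "g < 1" by linarith
    then show ?thesis
    proof cases
      case 1
      then have "(2 - g) * ln g \<le> 0" by (intro mult_nonpos_nonneg) auto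
      then show ?thesis using 1 by simp
    next
      case 2
      then have "(2 - g) * ln g \<le> 1 * ln g" by (intro mult_right_mono) auto
      then show ?thesis using ln by simp
    next
      case 3
      then have "(2 - g) * ln g \<le> 1 * ln g" using g by (intro mult_right_mono_neg) auto
      then show ?thesis using ln by simp
    qed
  qed
  then have 2: "g\<^sup>2 * ((2 - g) * ln g) \<le> g\<^sup>2 * (g - 1)" by (intro mult_left_mono) auto
  have "g * ln g = (g * (1 - g)\<^sup>2) * ln g + g\<^sup>2 * ((2 - g) * ln g)"
    by (simp add: power2_eq_square algebra_simps)
  then show ?thesis using 1 2 by linarith
qed simp

text \<open>The scalar inequality summed over the spectrum. On the right stand traces of polynomials
  in \<open>G\<close> that contain the factor \<open>G - G * G\<close>, so no eigenvalue of
  \<open>G\<close> has to be located.\<close>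

lemma mtrace_xlnx_le:
  assumes G: "psd n G" and \<delta>: "\<delta> > 0"
  shows "Re (mtrace (G * matfun n ln G))
    \<le> ln \<delta> * Re (mtrace ((G - G * G) * (1\<^sub>m n - G))) + Re (mtrace ((G - G * G) * (G - G * G))) / \<delta>
      - Re (mtrace (G * (G - G * G)))"
proof -
  obtain U g where U: "unitary n U" and Gg: "G = sform n U g" and g: "\<And>k. k < n \<Longrightarrow> g k \<ge> 0"
    using psd_spectral[OF G] by blast
  have minus: "sform n U f - sform n U h = sform n U (\<lambda>k. f k - h k)" for f h
  proof -
    have "sform n U f - sform n U h = sform n U f + complex_of_real (-1) \<cdot>\<^sub>m sform n U h"
      using carrier_matD[OF sform_carrier[OF U]] by (intro eq_matI) auto
    also have "\<dots> = sform n U (\<lambda>k. f k + (-1) * h k)"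
      unfolding sform_smult[OF U] sform_add[OF U] ..
    finally show ?thesis by simp
  qed
  have one: "1\<^sub>m n = sform n U (\<lambda>_. 1)" using sform_const[OF U, of 1] by simp
  have "(\<Sum>k<n. g k * ln (g k)) \<le> (\<Sum>k<n. ln \<delta> * (g k * (1 - g k)\<^sup>2) + (g k - (g k)\<^sup>2)\<^sup>2 / \<delta> + (g k)\<^sup>2 * (g k - 1))"
    using g \<delta> by (intro sum_mono xlnx_le) auto
  also have "\<dots> = ln \<delta> * (\<Sum>k<n. (g k - g k * g k) * (1 - g k)) + (\<Sum>k<n. (g k - g k * g k) * (g k - g k * g k)) / \<delta>
      - (\<Sum>k<n. g k * (g k - g k * g k))"
    unfolding sum_distrib_left sum_divide_distrib sum.distrib[symmetric] sum_subtractf[symmetric]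
    by (intro sum.cong refl) (simp add: power2_eq_square algebra_simps)
  finally show ?thesis
    unfolding one Gg matfun_sform[OF U] minus sform_mult[OF U] mtrace_sform[OF U] by simp
qed

section \<open>Rotation in the plane of two coordinates, with sine \<open>\<epsilon>\<close>\<close>

definition rot_entry :: "nat \<Rightarrow> nat \<Rightarrow> real \<Rightarrow> nat \<Rightarrow> nat \<Rightarrow> real" where
  "rot_entry i j \<epsilon> a k =
    (if a = i then (if k = i then sqrt (1 - \<epsilon>\<^sup>2) else if k = j then -\<epsilon> else 0)
     else if a = j then (if k = i then \<epsilon> else if k = j then sqrt (1 - \<epsilon>\<^sup>2) else 0)
     else if a = k then 1 else 0)"

definition rot :: "nat \<Rightarrow> nat \<Rightarrow> nat \<Rightarrow> real \<Rightarrow> complex mat" where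
  "rot n i j \<epsilon> = mat n n (\<lambda>(a,k). complex_of_real (rot_entry i j \<epsilon> a k))"

lemma rot_carrier [simp]: "rot n i j \<epsilon> \<in> carrier_mat n n"
  by (simp add: rot_def)

text \<open>Exact, not only to first order: since cosine squared is 1 - \<epsilon>^2, the
  conjugation changes only the block of \<open>i\<close> and \<open>j\<close>, and every change
  there carries the factor (d i - d j) \<epsilon>.\<close>

lemma rot_conj_diag:
  assumes ij: "i < n" "j < n" "i \<noteq> j" and \<epsilon>: "0 < \<epsilon>" "\<epsilon> < 1"
  shows "rot n i j \<epsilon> * mat_diag n (\<lambda>k. complex_of_real (d k)) * adj (rot n i j \<epsilon>)
    = mat_diag n (\<lambda>k. complex_of_real (d k)) + complex_of_real ((d i - d j) * \<epsilon>) \<cdot>\<^sub>m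
      (complex_of_real (-\<epsilon>) \<cdot>\<^sub>m munit n i i + complex_of_real (sqrt (1 - \<epsilon>\<^sup>2)) \<cdot>\<^sub>m (munit n i j + munit n j i)
        + complex_of_real \<epsilon> \<cdot>\<^sub>m munit n j j)"
    (is "?L = ?R")
proof (rule eq_matI)
  fix a b assume "a < dim_row ?R" "b < dim_col ?R"
  then have ab: "a < n" "b < n" by (auto simp: munit_def)
  let ?f = "\<lambda>k. rot_entry i j \<epsilon> a k * d k * rot_entry i j \<epsilon> b k"
  have sq: "sqrt (1 - \<epsilon>\<^sup>2) * sqrt (1 - \<epsilon>\<^sup>2) = 1 - \<epsilon>\<^sup>2"
    using \<epsilon> by (simp add: power_le_one)
  \<comment> \<open>The summands \<open>i\<close> and \<open>j\<close> are singled out; on all other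
    coordinates the rotation is the identity.\<close>
  have "{..<n} = insert i (insert j ({..<n} - {i,j}))" using ij by auto
  then have "sum ?f {..<n} = ?f i + (?f j + sum ?f ({..<n} - {i,j}))"
    using ij by (metis (no_types, lifting) Diff_iff finite_Diff finite_insert finite_lessThan insertE insertI1 insertI2 sum.insert)
  also have "sum ?f ({..<n} - {i,j}) = (\<Sum>k\<in>{..<n} - {i,j}. if k = a then (if a = b then d a else 0) else 0)"
    by (intro sum.cong) (auto simp: rot_entry_def)
  also have "\<dots> = (if a \<noteq> i \<and> a \<noteq> j \<and> a = b then d a else 0)" using ab by simp
  finally have S: "sum ?f {..<n} = ?f i + (?f j + (if a \<noteq> i \<and> a \<noteq> j \<and> a = b then d a else 0))" .
  have "?L $$ (a,b) = complex_of_real (sum ?f {..<n})"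
    using ab by (simp add: mat_diag_mult_right[of _ n n])
      (simp add: rot_def scalar_prod_def atLeast0LessThan)
  also have "sum ?f {..<n} = (if a = b then d a else 0) + (d i - d j) * \<epsilon> *
      (-\<epsilon> * (if a = i \<and> b = i then 1 else 0) + sqrt (1 - \<epsilon>\<^sup>2) * ((if a = i \<and> b = j then 1 else 0) + (if a = j \<and> b = i then 1 else 0))
        + \<epsilon> * (if a = j \<and> b = j then 1 else 0))"
  proof -
    define c where "c = sqrt (1 - \<epsilon>\<^sup>2)"
    have "c * d i * c = (c * c) * d i" "c * d j * c = (c * c) * d j" by simp_all
    then have c: "c * d i * c = (1 - \<epsilon>\<^sup>2) * d i" "c * d j * c = (1 - \<epsilon>\<^sup>2) * d j"
      using sq by (simp_all add: c_def)
    have 1: "c * d i * c + (-\<epsilon>) * d j * (-\<epsilon>) = d i + (d i - d j) * \<epsilon> * (-\<epsilon>)"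
      "\<epsilon> * d i * \<epsilon> + c * d j * c = d j + (d i - d j) * \<epsilon> * \<epsilon>"
      unfolding c by (simp_all add: algebra_simps power2_eq_square)
    have 2: "c * d i * \<epsilon> + (-\<epsilon>) * d j * c = (d i - d j) * \<epsilon> * c"
      "\<epsilon> * d i * c + c * d j * (-\<epsilon>) = (d i - d j) * \<epsilon> * c"
      by (simp_all add: algebra_simps)
    consider "a = i" "b = i" | "a = i" "b = j" | "a = j" "b = i" | "a = j" "b = j"
      | "a \<noteq> i" "a \<noteq> j" | "b \<noteq> i" "b \<noteq> j" by blast
    then show ?thesis
      unfolding S unfolding c_def[symmetric] rot_entry_def
      by cases (use ij 1 2 in \<open>simp_all add: c_def[symmetric] split del: if_split cong: if_cong\<close>, auto)
  qed
  also have "complex_of_real \<dots> = ?R $$ (a,b)"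
  proof -
    have "munit n k l $$ (a,b) = complex_of_real (if a = k \<and> b = l then 1 else 0)" for k l
      using ab by (simp add: munit_def)
    moreover have "mat_diag n (\<lambda>k. complex_of_real (d k)) $$ (a,b) = complex_of_real (if a = b then d a else 0)"
      using ab by (simp add: mat_diag_def)
    moreover have "dim_row (munit n k l) = n" "dim_col (munit n k l) = n" for k l by (simp_all add: munit_def)
    ultimately show ?thesis using ab by (simp split del: if_split)
  qed
  finally show "?L $$ (a,b) = ?R $$ (a,b)" .
qed (auto simp: rot_def munit_def)

text \<open>For constant \<open>d\<close> the correction in \<open>rot_conj_diag\<close>
  vanishes.\<close>

lemma rot_unitary:
  assumes "i < n" "j < n" "i \<noteq> j" "0 < \<epsilon>" "\<epsilon> < 1"
  shows "unitary n (rot n i j \<epsilon>)"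
proof -
  have "rot n i j \<epsilon> * adj (rot n i j \<epsilon>) = 1\<^sub>m n"
    using rot_conj_diag[OF assms, of "\<lambda>_. 1"]
    by (simp add: right_add_zero_mat[of _ n n])
       (auto intro!: eq_matI simp: munit_def)
  then show ?thesis
    using mat_mult_left_right_inverse[of "rot n i j \<epsilon>" n "adj (rot n i j \<epsilon>)"] by (simp add: unitary_def)
qed

section \<open>The perturbed projection in the common eigenbasis of \<open>sig\<close> and
  \<open>P\<close>\<close>

locale test_family = faithful_conditional_expectation +
  fixes U :: "complex mat" and s :: "nat \<Rightarrow> real" and p :: "nat set" and i j :: nat
  assumes U: "unitary n U" and sig_eq: "sig = sform n U s"
    and P_N: "sform n U (\<lambda>k. if k \<in> p then 1 else 0) \<in> N"
    and i: "i < n" "i \<in> p" and j: "j < n" "j \<notin> p"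
    and ij_N: "eunit n U i j \<notin> N"
begin

definition P where "P = sform n U (\<lambda>k. if k \<in> p then 1 else 0)"
abbreviation e where "e \<equiv> eunit n U"
definition S where "S r = sform n U (\<lambda>k. s k powr r)"
text \<open>Together with \<open>adj F\<close> these are the images under \<open>E\<close> of the
  four matrix units of the rotated plane.\<close>

definition A where "A = E (e i i)"
definition F where "F = E (e i j)"
definition D where "D = E (e j j)"

lemma i_neq_j: "i \<noteq> j" using i j by auto

lemma s_pos: "k < n \<Longrightarrow> s k > 0" by (rule sig_pos[OF U sig_eq])

lemma S_carrier [simp]: "S r \<in> carrier_mat n n" using U by (simp add: S_def)

lemma adj_S [simp]: "adj (S r) = S r" using U by (simp add: S_def)

lemma S_mult: "S a * S b = S (a + b)"
  unfolding S_def sform_mult[OF U] by (simp add: powr_add)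

lemma S_0: "S 0 = 1\<^sub>m n"
proof -
  have "S 0 = sform n U (\<lambda>_. 1)" unfolding S_def using s_pos by (intro sform_cong) fastforce
  then show ?thesis using sform_const[OF U, of 1] by simp
qed

lemma S_1: "S 1 = sig"
  unfolding S_def sig_eq using s_pos by (intro sform_cong) (simp add: less_imp_le)

lemma spow_eq: "spow n E r = S r"
  unfolding spow_def S_def sig_def[symmetric] sig_eq by (rule matfun_sform[OF U])

text \<open>Powers of \<open>sig\<close> inherit the commutation of \<open>sig\<close> with
  \<open>N\<close>.\<close>

lemma S_commute:
  assumes "L \<in> N" shows "S r * L = L * S r"
  unfolding S_def
  by (rule sform_intertwine[OF U U]) (use assms sig_commute[OF assms] sig_eq in auto)

lemma S_conj_eunit:
  assumes "k < n" "l < n"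
  shows "S r * e k l * S r = complex_of_real ((s k * s l) powr r) \<cdot>\<^sub>m e k l"
proof -
  have "S r * e k l * S r = (complex_of_real (s k powr r) * complex_of_real (s l powr r)) \<cdot>\<^sub>m e k l"
    unfolding S_def using assms U
    by (simp add: sform_mult_eunit eunit_mult_sform square_smult[of _ n] smult_smult_mat)
  also have "complex_of_real (s k powr r) * complex_of_real (s l powr r) = complex_of_real ((s k * s l) powr r)"
    using s_pos assms by (simp add: powr_mult less_imp_le)
  finally show ?thesis .
qed

lemma e_carrier [simp]: "e k l \<in> carrier_mat n n" using U by simp

lemma PN [simp]: "P \<in> N" using P_N by (simp add: P_def)
lemma P_carrier [simp]: "P \<in> carrier_mat n n" by simp
lemma AN [simp]: "A \<in> N" by (simp add: A_def)
lemma FN [simp]: "F \<in> N" by (simp add: F_def)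
lemma DN [simp]: "D \<in> N" by (simp add: D_def)

lemma PP: "P * P = P" unfolding P_def sform_mult[OF U] by (intro sform_cong) auto
lemma adj_P [simp]: "adj P = P" unfolding P_def using U by simp

lemma E_zero: "E (0\<^sub>m n n) = 0\<^sub>m n n" by (rule E_N) simp

lemma Pe: "k < n \<Longrightarrow> P * e k l = (if k \<in> p then e k l else 0\<^sub>m n n)"
  and eP: "l < n \<Longrightarrow> e k l * P = (if l \<in> p then e k l else 0\<^sub>m n n)"
proof -
  have z: "(0::complex) \<cdot>\<^sub>m e k l = 0\<^sub>m n n" using carrier_matD[OF e_carrier] by (intro eq_matI) auto
  show "k < n \<Longrightarrow> P * e k l = (if k \<in> p then e k l else 0\<^sub>m n n)"
    unfolding P_def by (simp add: sform_mult_eunit[OF U] z)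
  show "l < n \<Longrightarrow> e k l * P = (if l \<in> p then e k l else 0\<^sub>m n n)"
    unfolding P_def by (simp add: eunit_mult_sform[OF U] z)
qed

lemma F_adj: "E (e j i) = adj F"
  unfolding F_def using E_adj[of "e i j"] by (simp add: adj_eunit[OF U])

text \<open>\<open>P\<close> lies in \<open>N\<close>, so it passes through \<open>E\<close>, and on
  the matrix units it acts as 1 or 0. Thus \<open>F\<close> maps the complement of \<open>P\<close>
  into its range, while \<open>A\<close> and \<open>D\<close> live on the two corners.\<close>

lemma PF: "P * F = F" and FP: "F * P = 0\<^sub>m n n" and PFa: "P * adj F = 0\<^sub>m n n" and FaP: "adj F * P = adj F"
  and PA: "P * A = A" and AP: "A * P = A" and PD: "P * D = 0\<^sub>m n n" and DP: "D * P = 0\<^sub>m n n"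
  unfolding F_adj[symmetric] unfolding F_def A_def D_def using i j
  by (simp_all add: E_left[OF PN, symmetric] E_right[OF PN, symmetric] Pe eP E_zero)

text \<open>The weight of the off-diagonal units in \<open>Y\<close>: conjugation by sig^(-1/2)
  turns their coefficient \<open>s i\<close> into \<open>\<kappa>\<close>.\<close>

definition \<kappa> where "\<kappa> = sqrt (s i / s j)"

lemma \<kappa>_pos: "\<kappa> > 0" using s_pos i j by (simp add: \<kappa>_def)

lemma coeffs: "s i * (s i * s i) powr (-1/2) = 1" "s i * (s i * s j) powr (-1/2) = \<kappa>"
  "s i * (s j * s i) powr (-1/2) = \<kappa>" "s i * (s j * s j) powr (-1/2) = \<kappa>\<^sup>2"
proof -
  have pos: "s i > 0" "s j > 0" using s_pos i j by auto
  have pw: "x powr (-1/2) = 1 / sqrt x" if "x > 0" for x :: real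
    using that powr_minus[of x "1/2"] by (simp add: powr_half_sqrt inverse_eq_divide)
  show "s i * (s i * s i) powr (-1/2) = 1" "s i * (s j * s j) powr (-1/2) = \<kappa>\<^sup>2"
    using pos unfolding pw[OF mult_pos_pos[OF pos(1) pos(1)]] pw[OF mult_pos_pos[OF pos(2) pos(2)]]
    by (simp_all add: \<kappa>_def)
  show *: "s i * (s i * s j) powr (-1/2) = \<kappa>"
    using pos unfolding pw[OF mult_pos_pos[OF pos]]
    by (simp add: \<kappa>_def real_sqrt_mult real_sqrt_divide field_simps)
  show "s i * (s j * s i) powr (-1/2) = \<kappa>" using * by (simp add: mult.commute)
qed

text \<open>The cosine belonging to the sine \<open>\<epsilon>\<close>.\<close>

definition c where "c \<epsilon> = sqrt (1 - \<epsilon>\<^sup>2)"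

lemma c_sq: "0 < \<epsilon> \<Longrightarrow> \<epsilon> < 1 \<Longrightarrow> c \<epsilon> * c \<epsilon> = 1 - \<epsilon>\<^sup>2"
  unfolding c_def by (simp add: power_le_one)

lemma c_bound: "0 < \<epsilon> \<Longrightarrow> \<epsilon> < 1 \<Longrightarrow> \<bar>c \<epsilon>\<bar> \<le> 1"
  unfolding c_def by (simp add: power_le_one)

text \<open>The bracket of \<open>rot_conj_diag\<close>, transported to the basis \<open>U\<close>;
  it stays bounded in \<open>\<epsilon>\<close>.\<close>

definition Q where "Q \<epsilon> = complex_of_real (-\<epsilon>) \<cdot>\<^sub>m e i i + complex_of_real (c \<epsilon>) \<cdot>\<^sub>m (e i j + e j i)
   + complex_of_real \<epsilon> \<cdot>\<^sub>m e j j"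

lemma Q_carrier [simp]: "Q \<epsilon> \<in> carrier_mat n n" by (simp add: Q_def)

definition W where "W \<epsilon> = U * rot n i j \<epsilon>"

lemma W_unitary: "0 < \<epsilon> \<Longrightarrow> \<epsilon> < 1 \<Longrightarrow> unitary n (W \<epsilon>)"
  unfolding W_def using U rot_unitary[OF i(1) j(1) i_neq_j] by (intro unitary_mult) auto

text \<open>\<open>W \<epsilon>\<close> rotates the columns \<open>i\<close> and \<open>j\<close> of
  \<open>U\<close>. As \<open>d j = 0\<close>, the difference of the two eigenvalues is
  \<open>d i\<close>.\<close>

lemma sform_W:
  assumes "0 < \<epsilon>" "\<epsilon> < 1" "d j = 0"
  shows "sform n (W \<epsilon>) d = sform n U d + complex_of_real (d i * \<epsilon>) \<cdot>\<^sub>m Q \<epsilon>"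
proof -
  have Uc [simp]: "U \<in> carrier_mat n n" using U by simp
  let ?D = "mat_diag n (\<lambda>k. complex_of_real (d k))"
  have "sform n (W \<epsilon>) d = U * (rot n i j \<epsilon> * ?D * adj (rot n i j \<epsilon>)) * adj U"
    unfolding sform_def W_def by (simp add: adj_mult[of _ n n _ n] square_assoc[of _ n])
  also have "\<dots> = sform n U d + complex_of_real (d i * \<epsilon>) \<cdot>\<^sub>m Q \<epsilon>"
    unfolding rot_conj_diag[OF i(1) j(1) i_neq_j assms(1,2)] assms(3) Q_def eunit_def sform_def c_def
    by (simp add: square_distrib[of _ n] square_smult[of _ n])
  finally show ?thesis .
qed

text \<open>The eigenvalues of sig^(1/2) P, which the rotation leaves unchanged.\<close>

definition dz where "dz k = (if k \<in> p then sqrt (s k) else 0)"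
definition Z where "Z \<epsilon> = sform n (W \<epsilon>) dz"
text \<open>The preimage of \<open>Z\<close> under \<open>Gamma n E (1/2)\<close>, whose outer
  factors are quarter powers of \<open>sig\<close>.\<close>

definition X where "X \<epsilon> = S (-1/4) * Z \<epsilon> * S (-1/4)"
text \<open>The argument of \<open>E\<close> inside \<open>ent2\<close>.\<close>

definition Y where "Y \<epsilon> = S (-1/2) * (Z \<epsilon> * Z \<epsilon>) * S (-1/2)"

lemma Z_carrier [simp]: "0 < \<epsilon> \<Longrightarrow> \<epsilon> < 1 \<Longrightarrow> Z \<epsilon> \<in> carrier_mat n n"
  unfolding Z_def using W_unitary by simp

lemma adj_Z: "0 < \<epsilon> \<Longrightarrow> \<epsilon> < 1 \<Longrightarrow> adj (Z \<epsilon>) = Z \<epsilon>"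
  unfolding Z_def using W_unitary by simp

lemma X_carrier [simp]: "0 < \<epsilon> \<Longrightarrow> \<epsilon> < 1 \<Longrightarrow> X \<epsilon> \<in> carrier_mat n n"
  unfolding X_def by simp

lemma Y_carrier [simp]: "0 < \<epsilon> \<Longrightarrow> \<epsilon> < 1 \<Longrightarrow> Y \<epsilon> \<in> carrier_mat n n"
  unfolding Y_def by simp

lemma Gamma_X:
  assumes "0 < \<epsilon>" "\<epsilon> < 1" shows "Gamma n E (1/2) (X \<epsilon>) = Z \<epsilon>"
proof -
  have "Gamma n E (1/2) (X \<epsilon>) = (S (1/4) * S (-1/4)) * Z \<epsilon> * (S (-1/4) * S (1/4))"
    unfolding Gamma_def spow_eq X_def using assms by (simp add: square_assoc[of _ n])
  then show ?thesis using assms unfolding S_mult by (simp add: S_0)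
qed

text \<open>\<open>X\<close> has the form M adj M with M = sig^(-1/4) Z^(1/2).\<close>

lemma psd_X:
  assumes \<epsilon>: "0 < \<epsilon>" "\<epsilon> < 1" shows "psd n (X \<epsilon>)"
proof -
  let ?R = "sform n (W \<epsilon>) (\<lambda>k. sqrt (dz k))"
  have W: "unitary n (W \<epsilon>)" using W_unitary[OF \<epsilon>] .
  have "Z \<epsilon> = ?R * ?R" unfolding Z_def sform_mult[OF W] dz_def using s_pos
    by (intro sform_cong) (auto simp: less_imp_le)
  then have "X \<epsilon> = (S (-1/4) * ?R) * adj (S (-1/4) * ?R)"
    unfolding X_def using W by (simp add: adj_mult[of _ n n _ n] square_assoc[of _ n])
  then show ?thesis using psd_mult_adj[of "S (-1/4) * ?R" n] W by simp
qed

lemma psd_Y: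
  assumes \<epsilon>: "0 < \<epsilon>" "\<epsilon> < 1" shows "psd n (Y \<epsilon>)"
proof -
  have "Y \<epsilon> = (S (-1/2) * Z \<epsilon>) * adj (S (-1/2) * Z \<epsilon>)"
    unfolding Y_def using \<epsilon> by (simp add: adj_mult[of _ n n _ n] square_assoc[of _ n] adj_Z)
  then show ?thesis using psd_mult_adj[of "S (-1/2) * Z \<epsilon>" n] \<epsilon> by simp
qed

lemma dz_j: "dz j = 0" using j by (simp add: dz_def)

lemma Z_eq: "0 < \<epsilon> \<Longrightarrow> \<epsilon> < 1 \<Longrightarrow> Z \<epsilon> = sform n U dz + complex_of_real (sqrt (s i) * \<epsilon>) \<cdot>\<^sub>m Q \<epsilon>"
  unfolding Z_def using sform_W[of \<epsilon> dz] i dz_j by (simp add: dz_def)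

definition ds where "ds k = (if k \<in> p then s k else 0)"

lemma ZZ_form: "0 < \<epsilon> \<Longrightarrow> \<epsilon> < 1 \<Longrightarrow> Z \<epsilon> * Z \<epsilon> = sform n (W \<epsilon>) ds"
  unfolding Z_def using W_unitary[of \<epsilon>] s_pos
  by (simp add: sform_mult) (intro sform_cong, auto simp: dz_def ds_def less_imp_le)

lemma ZZ_eq: "0 < \<epsilon> \<Longrightarrow> \<epsilon> < 1 \<Longrightarrow> Z \<epsilon> * Z \<epsilon> = sform n U ds + complex_of_real (s i * \<epsilon>) \<cdot>\<^sub>m Q \<epsilon>"
  unfolding ZZ_form using sform_W[of \<epsilon> ds] i j by (simp add: ds_def)

definition K where "K \<epsilon> = complex_of_real (sqrt (s i)) \<cdot>\<^sub>m (S (-1/4) * Q \<epsilon> * S (-1/4))"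

lemma K_carrier [simp]: "K \<epsilon> \<in> carrier_mat n n" by (simp add: K_def)

text \<open>The unrotated part sig^(-1/4) sig^(1/2) P sig^(-1/4) collapses to \<open>P\<close>,
  because all factors are diagonal in the basis \<open>U\<close>.\<close>

lemma X_eq:
  assumes \<epsilon>: "0 < \<epsilon>" "\<epsilon> < 1" shows "X \<epsilon> = P + complex_of_real \<epsilon> \<cdot>\<^sub>m K \<epsilon>"
proof -
  have "S (-1/4) * sform n U dz * S (-1/4) = P"
    unfolding S_def P_def sform_mult[OF U]
  proof (rule sform_cong)
    fix k assume "k < n"
    then have "s k > 0" by (rule s_pos)
    then have "s k powr (-1/4) * s k powr (1/2) * s k powr (-1/4) = 1"
      by (simp add: powr_add[symmetric])
    then show "s k powr (-1/4) * dz k * s k powr (-1/4) = (if k \<in> p then 1 else 0)"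
      using \<open>s k > 0\<close> by (simp add: dz_def powr_half_sqrt)
  qed
  then show ?thesis unfolding X_def Z_eq[OF \<epsilon>] K_def using U
    by (simp add: square_distrib[of _ n] square_smult[of _ n] smult_smult_mat mult.commute)
qed

text \<open>The part that is off-diagonal with respect to \<open>P\<close> comes first; the corner
  parts carry an additional factor \<open>\<epsilon>\<close>.\<close>

definition L where "L \<epsilon> = complex_of_real (c \<epsilon> * \<kappa>) \<cdot>\<^sub>m (F + adj F)
   + complex_of_real \<epsilon> \<cdot>\<^sub>m (complex_of_real (\<kappa>\<^sup>2) \<cdot>\<^sub>m D - A)"

text \<open>The square of \<open>Z\<close> is the rotated sig P, so the perturbation has coefficient
  \<open>s i\<close>; conjugation by sig^(-1/2) rescales the four units by the factors in
  \<open>coeffs\<close>.\<close>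

lemma Y_eq:
  assumes \<epsilon>: "0 < \<epsilon>" "\<epsilon> < 1"
  shows "Y \<epsilon> = P + complex_of_real \<epsilon> \<cdot>\<^sub>m (complex_of_real (-\<epsilon>) \<cdot>\<^sub>m e i i
    + complex_of_real (c \<epsilon> * \<kappa>) \<cdot>\<^sub>m (e i j + e j i) + complex_of_real (\<epsilon> * \<kappa>\<^sup>2) \<cdot>\<^sub>m e j j)"
proof -
  have 1: "S (-1/2) * sform n U ds * S (-1/2) = P"
    unfolding S_def P_def sform_mult[OF U]
  proof (rule sform_cong)
    fix k assume "k < n"
    then have "s k > 0" by (rule s_pos)
    then have "s k powr (-1/2) * s k powr 1 * s k powr (-1/2) = 1"
      by (simp only: powr_add[symmetric]) simp
    then show "s k powr (-1/2) * ds k * s k powr (-1/2) = (if k \<in> p then 1 else 0)"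
      using \<open>s k > 0\<close> by (simp add: ds_def)
  qed
  have "S (-1/2) * (complex_of_real (s i * \<epsilon>) \<cdot>\<^sub>m Q \<epsilon>) * S (-1/2)
     = complex_of_real (s i * \<epsilon>) \<cdot>\<^sub>m (complex_of_real (-\<epsilon>) \<cdot>\<^sub>m (S (-1/2) * e i i * S (-1/2))
    + complex_of_real (c \<epsilon>) \<cdot>\<^sub>m (S (-1/2) * e i j * S (-1/2) + S (-1/2) * e j i * S (-1/2))
    + complex_of_real \<epsilon> \<cdot>\<^sub>m (S (-1/2) * e j j * S (-1/2)))"
    unfolding Q_def by (simp add: square_distrib[of _ n] square_smult[of _ n])
  also have "\<dots> = complex_of_real \<epsilon> \<cdot>\<^sub>m (complex_of_real (-\<epsilon> * (s i * (s i * s i) powr (-1/2))) \<cdot>\<^sub>m e i i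
    + (complex_of_real (c \<epsilon> * (s i * (s i * s j) powr (-1/2))) \<cdot>\<^sub>m e i j
       + complex_of_real (c \<epsilon> * (s i * (s j * s i) powr (-1/2))) \<cdot>\<^sub>m e j i)
    + complex_of_real (\<epsilon> * (s i * (s j * s j) powr (-1/2))) \<cdot>\<^sub>m e j j)"
    using i j carrier_matD[OF e_carrier]
    by (simp only: S_conj_eunit) (intro eq_matI, auto simp: algebra_simps)
  also have "\<dots> = complex_of_real \<epsilon> \<cdot>\<^sub>m (complex_of_real (-\<epsilon>) \<cdot>\<^sub>m e i i
    + complex_of_real (c \<epsilon> * \<kappa>) \<cdot>\<^sub>m (e i j + e j i) + complex_of_real (\<epsilon> * \<kappa>\<^sup>2) \<cdot>\<^sub>m e j j)"
    unfolding coeffs by (simp add: add_smult_distrib_left_mat[of _ n n])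
  finally show ?thesis unfolding Y_def ZZ_eq[OF \<epsilon>] using U 1
    by (simp add: square_distrib[of _ n])
qed

definition G where "G \<epsilon> = E (Y \<epsilon>)"

lemma G_eq:
  assumes \<epsilon>: "0 < \<epsilon>" "\<epsilon> < 1"
  shows "G \<epsilon> = P + complex_of_real \<epsilon> \<cdot>\<^sub>m L \<epsilon>"
proof -
  have "G \<epsilon> = P + complex_of_real \<epsilon> \<cdot>\<^sub>m (complex_of_real (-\<epsilon>) \<cdot>\<^sub>m A
    + complex_of_real (c \<epsilon> * \<kappa>) \<cdot>\<^sub>m (F + adj F) + complex_of_real (\<epsilon> * \<kappa>\<^sup>2) \<cdot>\<^sub>m D)"
    unfolding G_def Y_eq[OF \<epsilon>] A_def D_def F_adj[symmetric] unfolding F_def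
    by (simp add: E_add E_smult E_N)
  moreover have "complex_of_real (-\<epsilon>) \<cdot>\<^sub>m A
    + complex_of_real (c \<epsilon> * \<kappa>) \<cdot>\<^sub>m (F + adj F) + complex_of_real (\<epsilon> * \<kappa>\<^sup>2) \<cdot>\<^sub>m D = L \<epsilon>"
    unfolding L_def using carrier_matD[OF N_carrier[OF AN]] carrier_matD[OF N_carrier[OF DN]] carrier_matD[OF N_carrier[OF FN]]
    by (intro eq_matI) (auto simp: algebra_simps)
  ultimately show ?thesis by simp
qed

lemma psd_G: "0 < \<epsilon> \<Longrightarrow> \<epsilon> < 1 \<Longrightarrow> psd n (G \<epsilon>)"
  unfolding G_def by (intro E_psd psd_Y)

text \<open>\<open>P\<close> is fixed by \<open>E\<close>, so E X - X = \<epsilon> V with V = E K -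
  K. The first-order term pairs \<open>P\<close> with V and equals Tr (P E V) / n, where E V =
  0.\<close>

lemma dirichlet_X:
  assumes \<epsilon>: "0 < \<epsilon>" "\<epsilon> < 1"
  shows "dirichlet2 n E (X \<epsilon>)
    = - \<epsilon>\<^sup>2 * Re (mtrace (S (1/2) * adj (K \<epsilon>) * S (1/2) * (E (K \<epsilon>) - K \<epsilon>)))"
proof -
  let ?V = "E (K \<epsilon>) - K \<epsilon>"
  have V: "?V \<in> carrier_mat n n" by simp
  have lX: "E (X \<epsilon>) - X \<epsilon> = complex_of_real \<epsilon> \<cdot>\<^sub>m ?V"
    unfolding X_eq[OF \<epsilon>] using carrier_matD[OF P_carrier] carrier_matD[OF K_carrier] carrier_matD[OF E_carrier[OF K_carrier]]
    by (simp add: E_add E_smult E_N) (intro eq_matI, auto simp: algebra_simps)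
  have aX: "adj (X \<epsilon>) = P + complex_of_real \<epsilon> \<cdot>\<^sub>m adj (K \<epsilon>)"
    unfolding X_eq[OF \<epsilon>] by (simp add: adj_add[of _ n n] adj_smult)
  have "S (1/2) * P * S (1/2) = P * (S (1/2) * S (1/2))"
    by (simp add: S_commute square_assoc[of _ n])
  also have "\<dots> = sig * P" by (simp add: S_mult S_1 sig_commute)
  finally have SPS: "S (1/2) * P * S (1/2) = sig * P" .
  have "E ?V = 0\<^sub>m n n" using carrier_matD[OF E_carrier[OF K_carrier]]
    by (simp add: E_minus E_N)
  then have "mtrace (E (P * ?V)) = 0"
    by (simp add: E_left right_mult_zero_mat[of _ n n] mtrace_def)
  then have zero: "mtrace (S (1/2) * P * S (1/2) * ?V) = 0"
    unfolding SPS by (simp add: square_assoc[of _ n] sig_trace)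
  have "sigma_inner n E (X \<epsilon>) (lindbladian E (X \<epsilon>)) = mtrace (complex_of_real \<epsilon> \<cdot>\<^sub>m (S (1/2) * P * S (1/2) * ?V)
      + complex_of_real \<epsilon> \<cdot>\<^sub>m (complex_of_real \<epsilon> \<cdot>\<^sub>m (S (1/2) * adj (K \<epsilon>) * S (1/2) * ?V)))"
    unfolding sigma_inner_def lindbladian_def spow_eq lX aX
    by (simp add: square_distrib(1,2)[of _ n] square_smult[of _ n] add_smult_distrib_left_mat[of _ n n])
  also have "\<dots> = complex_of_real (\<epsilon>\<^sup>2) * mtrace (S (1/2) * adj (K \<epsilon>) * S (1/2) * ?V)"
    using zero V by (simp add: mtrace_add[of _ n] mtrace_smult[of _ n] power2_eq_square)
  finally show ?thesis unfolding dirichlet2_def by simp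
qed

section \<open>The entropy of the test family\<close>

lemma mtrace_eunit: "k < n \<Longrightarrow> l < n \<Longrightarrow> mtrace (e k l) = (if k = l then 1 else 0)"
  unfolding eunit_def mtrace_conj_unitary[OF U munit_carrier]
  by (auto simp: mtrace_def munit_def)

text \<open>Off-diagonal units have no trace against a diagonal matrix, so only the two diagonal
  units of \<open>Q\<close> contribute, and these carry a second factor
  \<open>\<epsilon>\<close>.\<close>

lemma mtrace_ZZ_ln_sig:
  assumes \<epsilon>: "0 < \<epsilon>" "\<epsilon> < 1"
  shows "mtrace (Z \<epsilon> * Z \<epsilon> * sform n U (\<lambda>k. ln (s k)))
    = complex_of_real ((\<Sum>k<n. ds k * ln (s k)) + \<epsilon>\<^sup>2 * s i * (ln (s j) - ln (s i)))"
proof -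
  let ?C = "sform n U (\<lambda>k. ln (s k))"
  have C: "?C \<in> carrier_mat n n" using U by simp
  have "mtrace (Q \<epsilon> * ?C) = complex_of_real (\<epsilon> * (ln (s j) - ln (s i)))"
    unfolding Q_def using i j i_neq_j C
    by (simp add: square_distrib[of _ n] square_smult[of _ n] eunit_mult_sform[OF U]
        mtrace_add[of _ n] mtrace_smult[of _ n] mtrace_eunit algebra_simps)
  moreover have "mtrace (Z \<epsilon> * Z \<epsilon> * ?C)
      = complex_of_real (\<Sum>k<n. ds k * ln (s k)) + complex_of_real (s i * \<epsilon>) * mtrace (Q \<epsilon> * ?C)"
    unfolding ZZ_eq[OF \<epsilon>] using U C
    by (simp add: square_distrib[of _ n] square_smult[of _ n] mtrace_add[of _ n] mtrace_smult[of _ n]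
        sform_mult mtrace_sform)
  ultimately show ?thesis by (simp add: power2_eq_square)
qed

text \<open>Rotation keeps the spectrum of \<open>Z\<close>, so the term with ln Z is constant and
  cancels against the constant part of the term with ln sig. The middle term moves to
  \<open>G\<close>, because ln G lies in \<open>N\<close> and commutes with
  \<open>sig\<close>.\<close>

lemma ent_X:
  assumes \<epsilon>: "0 < \<epsilon>" "\<epsilon> < 1"
  shows "ent2 n E (X \<epsilon>) = \<epsilon>\<^sup>2 * s i * (ln (s i) - ln (s j)) / 2
    - Re (mtrace (G \<epsilon> * matfun n ln (G \<epsilon>))) / (2 * real n)"
proof -
  have W: "unitary n (W \<epsilon>)" by (rule W_unitary[OF \<epsilon>])
  have Zc [simp]: "Z \<epsilon> \<in> carrier_mat n n" using \<epsilon> by simp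
  have GN: "G \<epsilon> \<in> N" unfolding G_def using \<epsilon> by simp
  obtain V g where V: "unitary n V" and Gg: "G \<epsilon> = sform n V g" using psd_spectral[OF psd_G[OF \<epsilon>]] by blast
  define B where "B = matfun n ln (G \<epsilon>)"
  have B: "B = sform n V (\<lambda>k. ln (g k))" unfolding B_def Gg by (rule matfun_sform[OF V])
  have BN: "B \<in> N" unfolding B using sform_fun_in_N[OF V GN[unfolded Gg]] .
  have Bc [simp]: "B \<in> carrier_mat n n" using BN by simp
  have Yc [simp]: "Y \<epsilon> \<in> carrier_mat n n" using \<epsilon> by simp
  define C where "C = sform n U (\<lambda>k. ln (s k))"
  have C: "matfun n ln (sigma_tr n E) = C" unfolding sig_def[symmetric] sig_eq C_def by (rule matfun_sform[OF U])
  have Cc [simp]: "C \<in> carrier_mat n n" unfolding C_def using U by simp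
  define Lz where "Lz = sform n (W \<epsilon>) (\<lambda>k. ln (dz k))"
  have Lz: "matfun n ln (Z \<epsilon>) = Lz" unfolding Z_def Lz_def by (rule matfun_sform[OF W])
  have Lzc [simp]: "Lz \<in> carrier_mat n n" unfolding Lz_def using W by simp
  have "Z \<epsilon> * Z \<epsilon> * Lz = sform n (W \<epsilon>) (\<lambda>k. ds k * ln (dz k))"
    unfolding ZZ_form[OF \<epsilon>] Lz_def by (rule sform_mult[OF W])
  \<comment> \<open>Where \<open>dz\<close> vanishes so does \<open>ds\<close>, so the value of
    \<open>ln 0\<close> is immaterial.\<close>
  also have "\<dots> = sform n (W \<epsilon>) (\<lambda>k. ds k * ln (s k) / 2)"
    by (rule sform_cong) (auto simp: ds_def dz_def ln_sqrt dest: s_pos)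
  finally have t1: "mtrace (Z \<epsilon> * Z \<epsilon> * Lz) = complex_of_real ((\<Sum>k<n. ds k * ln (s k)) / 2)"
    by (simp add: mtrace_sform[OF W] sum_divide_distrib)
  have t3: "mtrace (Z \<epsilon> * Z \<epsilon> * C)
    = complex_of_real ((\<Sum>k<n. ds k * ln (s k)) + \<epsilon>\<^sup>2 * s i * (ln (s j) - ln (s i)))"
    unfolding C_def by (rule mtrace_ZZ_ln_sig[OF \<epsilon>])
  \<comment> \<open>Undo the conjugation in \<open>Y\<close>; cyclicity and commutation then collect
    a full \<open>sig\<close>, and a trace against \<open>sig\<close> is a trace of
    \<open>E\<close>.\<close>
  have t2: "mtrace (Z \<epsilon> * Z \<epsilon> * B) = complex_of_real (1 / real n) * mtrace (G \<epsilon> * B)"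
  proof -
    have "S (1/2) * Y \<epsilon> * S (1/2) = (S (1/2) * S (-1/2)) * (Z \<epsilon> * Z \<epsilon>) * (S (-1/2) * S (1/2))"
      unfolding Y_def by (simp add: square_assoc[of _ n])
    then have ZZ: "Z \<epsilon> * Z \<epsilon> = S (1/2) * Y \<epsilon> * S (1/2)" unfolding S_mult by (simp add: S_0)
    have "mtrace (Z \<epsilon> * Z \<epsilon> * B) = mtrace (S (1/2) * (Y \<epsilon> * (S (1/2) * B)))"
      unfolding ZZ by (simp add: square_assoc[of _ n])
    also have "\<dots> = mtrace ((Y \<epsilon> * (S (1/2) * B)) * S (1/2))" by (rule mtrace_commute[of _ n]) auto
    also have "(Y \<epsilon> * (S (1/2) * B)) * S (1/2) = Y \<epsilon> * (B * (S (1/2) * S (1/2)))"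
      unfolding S_commute[OF BN] by (simp add: square_assoc[of _ n])
    also have "B * (S (1/2) * S (1/2)) = sig * B" by (simp add: S_mult S_1 sig_commute[OF BN])
    also have "mtrace (Y \<epsilon> * (sig * B)) = mtrace (sig * B * Y \<epsilon>)" by (rule mtrace_commute[of _ n]) auto
    also have "\<dots> = complex_of_real (1 / real n) * mtrace (B * G \<epsilon>)"
      unfolding G_def using BN by (simp add: square_assoc[of _ n] sig_trace E_left)
    also have "mtrace (B * G \<epsilon>) = mtrace (G \<epsilon> * B)" using GN by (intro mtrace_commute[of _ n]) auto
    finally show ?thesis .
  qed
  have "ent2 n E (X \<epsilon>) = Re (mtrace (Z \<epsilon> * Z \<epsilon> * (Lz - complex_of_real (1/2) \<cdot>\<^sub>m B - complex_of_real (1/2) \<cdot>\<^sub>m C)))"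
    unfolding ent2_def Let_def Gamma_X[OF \<epsilon>] Lz C spow_eq Y_def[symmetric] G_def[symmetric] B_def ..
  also have "mtrace (Z \<epsilon> * Z \<epsilon> * (Lz - complex_of_real (1/2) \<cdot>\<^sub>m B - complex_of_real (1/2) \<cdot>\<^sub>m C))
      = mtrace (Z \<epsilon> * Z \<epsilon> * Lz) - complex_of_real (1/2) * mtrace (Z \<epsilon> * Z \<epsilon> * B) - complex_of_real (1/2) * mtrace (Z \<epsilon> * Z \<epsilon> * C)"
    by (simp add: square_distrib(3)[of _ n] square_smult[of _ n] mtrace_minus[of _ n] mtrace_smult[of _ n])
  finally show ?thesis unfolding t1 t2 t3 B_def[symmetric]
    by (simp add: field_simps)
qed

section \<open>The distance of \<open>G\<close> from being a projection\<close>

definition M where "M = complex_of_real (\<kappa>\<^sup>2) \<cdot>\<^sub>m D - A"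
definition R where "R \<epsilon> = M - P * M - M * P - L \<epsilon> * L \<epsilon>"

lemma M_carrier [simp]: "M \<in> carrier_mat n n" by (simp add: M_def)
lemma L_carrier [simp]: "L \<epsilon> \<in> carrier_mat n n" by (simp add: L_def)
lemma R_carrier [simp]: "R \<epsilon> \<in> carrier_mat n n" by (simp add: R_def)

text \<open>\<open>P\<close> is idempotent and the off-diagonal part b of \<open>L\<close> satisfies
  P b + b P = b, so the terms of order zero and one cancel.\<close>

lemma G_defect:
  assumes \<epsilon>: "0 < \<epsilon>" "\<epsilon> < 1"
  shows "G \<epsilon> - G \<epsilon> * G \<epsilon> = complex_of_real (\<epsilon>\<^sup>2) \<cdot>\<^sub>m R \<epsilon>"
proof -
  \<comment> \<open>The cancellation as an entrywise identity, with the matrix products treated as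
    unknowns related only by \<open>pb + bp = b\<close>.\<close>
  have lin: "(p + a \<cdot>\<^sub>m (b + a \<cdot>\<^sub>m m)) - (p + a \<cdot>\<^sub>m ((pb + a \<cdot>\<^sub>m pm)) + a \<cdot>\<^sub>m ((bp + a \<cdot>\<^sub>m mp) + a \<cdot>\<^sub>m ll))
      = (a * a) \<cdot>\<^sub>m (m - pm - mp - ll)"
    if "p \<in> carrier_mat n n" "b \<in> carrier_mat n n" "m \<in> carrier_mat n n" "pb \<in> carrier_mat n n" "pm \<in> carrier_mat n n"
     "bp \<in> carrier_mat n n" "mp \<in> carrier_mat n n" "ll \<in> carrier_mat n n" "pb + bp = b"
    for a :: complex and p b m pb pm bp mp ll
    unfolding that(9)[symmetric] using that(1-8) by (intro eq_matI) (auto simp: algebra_simps)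
  let ?a = "complex_of_real \<epsilon>" and ?b = "complex_of_real (c \<epsilon> * \<kappa>) \<cdot>\<^sub>m (F + adj F)"
  have L: "L \<epsilon> = ?b + ?a \<cdot>\<^sub>m M" by (simp add: L_def M_def)
  have b: "?b \<in> carrier_mat n n" by simp
  have pb: "P * ?b + ?b * P = ?b"
    by (simp add: square_distrib[of _ n] square_smult[of _ n] PF FP PFa FaP
        add_smult_distrib_left_mat[of _ n n, symmetric])
  have "G \<epsilon> * G \<epsilon> = P + ?a \<cdot>\<^sub>m (P * ?b + ?a \<cdot>\<^sub>m (P * M)) + ?a \<cdot>\<^sub>m ((?b * P + ?a \<cdot>\<^sub>m (M * P)) + ?a \<cdot>\<^sub>m (L \<epsilon> * L \<epsilon>))"
  proof -
    have "G \<epsilon> * G \<epsilon> = (P * P + ?a \<cdot>\<^sub>m (L \<epsilon> * P)) + (?a \<cdot>\<^sub>m (P * L \<epsilon>) + ?a \<cdot>\<^sub>m (?a \<cdot>\<^sub>m (L \<epsilon> * L \<epsilon>)))"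
      unfolding G_eq[OF \<epsilon>]
      by (simp add: square_distrib[of _ n] square_smult[of _ n] add_smult_distrib_left_mat[of _ n n])
    also have "\<dots> = P + ?a \<cdot>\<^sub>m (P * L \<epsilon>) + ?a \<cdot>\<^sub>m (L \<epsilon> * P + ?a \<cdot>\<^sub>m (L \<epsilon> * L \<epsilon>))"
    proof -
      have lin': "(p + a \<cdot>\<^sub>m lp) + (a \<cdot>\<^sub>m pl + a \<cdot>\<^sub>m (a \<cdot>\<^sub>m ll)) = p + a \<cdot>\<^sub>m pl + a \<cdot>\<^sub>m (lp + a \<cdot>\<^sub>m ll)"
        if "p \<in> carrier_mat n n" "lp \<in> carrier_mat n n" "pl \<in> carrier_mat n n" "ll \<in> carrier_mat n n"
        for p lp pl ll and a :: complex
        using that by (intro eq_matI) (auto simp: algebra_simps)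
      show ?thesis unfolding PP by (rule lin') simp_all
    qed
    also have "P * L \<epsilon> = P * ?b + ?a \<cdot>\<^sub>m (P * M)" unfolding L using b
      by (simp add: square_distrib(1,2)[of _ n] square_smult[of _ n])
    also have "L \<epsilon> * P = ?b * P + ?a \<cdot>\<^sub>m (M * P)" unfolding L using b
      by (simp add: square_distrib(1,2)[of _ n] square_smult[of _ n])
    finally show ?thesis .
  qed
  then have "G \<epsilon> - G \<epsilon> * G \<epsilon> = (?a * ?a) \<cdot>\<^sub>m (M - P * M - M * P - L \<epsilon> * L \<epsilon>)"
    unfolding G_eq[OF \<epsilon>] L using lin[OF P_carrier b M_carrier _ _ _ _ _ pb] b by (simp add: L[symmetric])
  then show ?thesis by (simp add: R_def power2_eq_square)
qed

definition r0 where "r0 = Re (mtrace D) - Re (mtrace (adj F * F))"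

text \<open>The number is Tr E (adj q q) for q = e i j - F, each cross term contributing adj F F by
  the bimodule property. Faithfulness applies, since q = 0 would put the unit into
  \<open>N\<close>.\<close>

lemma r0_pos: "r0 > 0"
proof -
  let ?q = "e i j - F"
  have q: "?q \<in> carrier_mat n n" by simp
  have "?q \<noteq> 0\<^sub>m n n"
  proof
    assume *: "?q = 0\<^sub>m n n"
    have "e i j = ?q + F"
      using carrier_matD[OF e_carrier] carrier_matD[OF N_carrier[OF FN]] by (intro eq_matI) auto
    also have "\<dots> = F" unfolding * by simp
    finally show False using ij_N by simp
  qed
  then have "Re (mtrace (E (adj ?q * ?q))) > 0" by (rule E_faithful[OF q])
  also have "adj ?q * ?q = (e j j - adj F * e i j) - (e j i * F - adj F * F)"
    using i j by (simp add: adj_minus[of _ n n] adj_eunit[OF U] square_distrib[of _ n] eunit_mult[OF U])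
  also have "E \<dots> = (D - adj F * F) - (adj F * F - adj F * F)"
    by (simp add: E_minus E_left E_right F_adj E_N) (simp add: D_def F_def)
  finally show ?thesis by (simp add: mtrace_minus[of _ n] r0_def)
qed

text \<open>The remainder in the square of \<open>L\<close>: those terms that carry a factor
  \<open>\<epsilon>\<close>, divided by it.\<close>

definition T where "T \<epsilon> = complex_of_real (c \<epsilon> * \<kappa>) \<cdot>\<^sub>m ((F + adj F) * M + M * (F + adj F))
    + complex_of_real \<epsilon> \<cdot>\<^sub>m (M * M)"

lemma T_carrier [simp]: "T \<epsilon> \<in> carrier_mat n n" by (simp add: T_def)

text \<open>Under the trace, cutting down by 1 - P removes \<open>A\<close> and the two mixed terms
  of \<open>R\<close>. Up to order \<open>\<epsilon>\<close> there remains \<kappa>^2 Tr D - c^2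
  \<kappa>^2 Tr (adj F F), and c^2 is at most 1.\<close>

lemma mtrace_defect:
  assumes \<epsilon>: "0 < \<epsilon>" "\<epsilon> < 1"
  shows "Re (mtrace (R \<epsilon> * (1\<^sub>m n - P))) \<ge> \<kappa>\<^sup>2 * r0 - \<epsilon> * Re (mtrace (T \<epsilon> * (1\<^sub>m n - P)))"
proof -
  let ?B = "F + adj F" and ?C = "1\<^sub>m n - P"
  have C [simp]: "?C \<in> carrier_mat n n" by simp
  have [simp]: "?B \<in> carrier_mat n n" by simp
  have CP: "P * ?C = 0\<^sub>m n n" "?C * P = 0\<^sub>m n n"
    using carrier_matD[OF P_carrier] by (auto simp: square_distrib[of _ n] PP intro!: eq_matI)
  have z: "mtrace (0\<^sub>m n n) = 0" by (simp add: mtrace_def)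
  have MC: "M * ?C = complex_of_real (\<kappa>\<^sup>2) \<cdot>\<^sub>m D"
    using carrier_matD[OF N_carrier[OF DN]] carrier_matD[OF N_carrier[OF AN]]
    by (simp add: M_def square_distrib[of _ n] square_smult[of _ n] DP AP) (intro eq_matI, auto)
  have "mtrace (P * M * ?C) = mtrace (M * ?C * P)"
    using mtrace_commute[of P n "M * ?C"] by (simp add: square_assoc[of _ n])
  then have t1: "mtrace (P * M * ?C) = 0"
    by (simp add: square_assoc[of _ n] CP z right_mult_zero_mat[of _ n n])
  have t2: "mtrace (M * P * ?C) = 0"
    by (simp add: square_assoc[of _ n] CP z right_mult_zero_mat[of _ n n])
  have FF: "F * F = 0\<^sub>m n n"
  proof -
    have "F * F = F * P * F" by (simp add: square_assoc[of _ n] PF)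
    then show ?thesis by (simp add: FP left_mult_zero_mat[of _ n n])
  qed
  have "?B * ?C = F"
    using carrier_matD[OF N_carrier[OF FN]]
    by (simp add: square_distrib[of _ n] FP FaP) (intro eq_matI, auto)
  then have "?B * (?B * ?C) = adj F * F" by (simp add: square_distrib[of _ n] FF)
  then have BB: "?B * ?B * ?C = adj F * F" by (simp add: square_assoc[of _ n])
  have LL: "L \<epsilon> * L \<epsilon> = complex_of_real (c \<epsilon> * \<kappa> * (c \<epsilon> * \<kappa>)) \<cdot>\<^sub>m (?B * ?B) + complex_of_real \<epsilon> \<cdot>\<^sub>m T \<epsilon>"
  proof -
    have lin: "(x * x) \<cdot>\<^sub>m bb + (y * x) \<cdot>\<^sub>m mb + ((x * y) \<cdot>\<^sub>m bm + (y * y) \<cdot>\<^sub>m mm)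
      = (x * x) \<cdot>\<^sub>m bb + y \<cdot>\<^sub>m (x \<cdot>\<^sub>m (bm + mb) + y \<cdot>\<^sub>m mm)"
      if "bb \<in> carrier_mat n n" "bm \<in> carrier_mat n n" "mb \<in> carrier_mat n n" "mm \<in> carrier_mat n n"
      for x y :: complex and bb bm mb mm
      using that by (intro eq_matI) (auto simp: algebra_simps)
    have exp: "(x \<cdot>\<^sub>m B + y \<cdot>\<^sub>m m) * (x \<cdot>\<^sub>m B + y \<cdot>\<^sub>m m)
      = (x * x) \<cdot>\<^sub>m (B * B) + y \<cdot>\<^sub>m (x \<cdot>\<^sub>m (B * m + m * B) + y \<cdot>\<^sub>m (m * m))"
      if "B \<in> carrier_mat n n" "m \<in> carrier_mat n n" for x y :: complex and B m
    proof -
      have "(x \<cdot>\<^sub>m B + y \<cdot>\<^sub>m m) * (x \<cdot>\<^sub>m B + y \<cdot>\<^sub>m m)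
        = (x * x) \<cdot>\<^sub>m (B * B) + (y * x) \<cdot>\<^sub>m (m * B) + ((x * y) \<cdot>\<^sub>m (B * m) + (y * y) \<cdot>\<^sub>m (m * m))"
        using that by (simp add: square_distrib[of _ n] square_smult[of _ n]
            add_smult_distrib_left_mat[of _ n n] smult_smult_mat mult.commute)
      then show ?thesis using lin[of "B * B" "B * m" "m * B" "m * m" x y] that by simp
    qed
    show ?thesis unfolding L_def M_def[symmetric] T_def using exp[of ?B M] by simp
  qed
  have "mtrace (L \<epsilon> * L \<epsilon> * ?C)
      = complex_of_real (c \<epsilon> * \<kappa> * (c \<epsilon> * \<kappa>)) * mtrace (adj F * F) + complex_of_real \<epsilon> * mtrace (T \<epsilon> * ?C)"
  proof -
    have "(x \<cdot>\<^sub>m B + y \<cdot>\<^sub>m t) * ?C = x \<cdot>\<^sub>m (B * ?C) + y \<cdot>\<^sub>m (t * ?C)"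
      if "B \<in> carrier_mat n n" "t \<in> carrier_mat n n" for x y B t
      using that C by (simp only: square_distrib(2)[of _ n] square_smult[of _ n] smult_carrier_mat)
    then show ?thesis unfolding LL
      by (simp add: BB mtrace_add[of _ n] mtrace_smult[of _ n] del: of_real_mult)
  qed
  then have "mtrace (R \<epsilon> * ?C) = complex_of_real (\<kappa>\<^sup>2) * mtrace D
      - (complex_of_real (c \<epsilon> * \<kappa> * (c \<epsilon> * \<kappa>)) * mtrace (adj F * F) + complex_of_real \<epsilon> * mtrace (T \<epsilon> * ?C))"
    unfolding R_def
    by (simp add: square_distrib(4)[of _ n] mtrace_minus[of _ n] t1 t2 MC mtrace_smult[of _ n]
        del: of_real_mult of_real_power)
  then have eq: "Re (mtrace (R \<epsilon> * ?C)) = \<kappa>\<^sup>2 * Re (mtrace D)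
      - (c \<epsilon> * \<kappa> * (c \<epsilon> * \<kappa>) * Re (mtrace (adj F * F)) + \<epsilon> * Re (mtrace (T \<epsilon> * ?C)))"
    by (simp del: of_real_mult of_real_power)
  have "Re (mtrace (adj F * F)) \<ge> 0"
    by (simp add: mtrace_adj_mult_self[of F n] sum_nonneg)
  moreover have "c \<epsilon> * \<kappa> * (c \<epsilon> * \<kappa>) \<le> \<kappa>\<^sup>2"
  proof -
    have "c \<epsilon> * \<kappa> * (c \<epsilon> * \<kappa>) = (1 - \<epsilon>\<^sup>2) * \<kappa>\<^sup>2" unfolding c_sq[OF \<epsilon>, symmetric] by (simp add: power2_eq_square)
    also have "\<dots> \<le> 1 * \<kappa>\<^sup>2" by (intro mult_right_mono) auto
    finally show ?thesis by simp
  qed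
  ultimately have "c \<epsilon> * \<kappa> * (c \<epsilon> * \<kappa>) * Re (mtrace (adj F * F)) \<le> \<kappa>\<^sup>2 * Re (mtrace (adj F * F))"
    by (rule mult_right_mono[rotated])
  then show ?thesis unfolding eq r0_def by (simp add: algebra_simps)
qed

section \<open>Uniform bounds and the limit of small \<open>\<epsilon>\<close>\<close>

lemma bounded_scalars: "cmod (complex_of_real (c \<epsilon> * \<kappa>)) \<le> \<kappa>" "cmod (complex_of_real \<epsilon>) \<le> 1"
  "cmod (complex_of_real (-\<epsilon>)) \<le> 1" "cmod (complex_of_real (c \<epsilon>)) \<le> 1"
  if "0 < \<epsilon>" "\<epsilon> < 1" for \<epsilon>
  using that c_bound[OF that] \<kappa>_pos
  by (simp_all only: norm_of_real abs_mult) (auto intro: mult_left_le_one_le)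

text \<open>The scalar rule is instantiated once for each \<open>\<epsilon>\<close>-dependent
  coefficient that occurs, with its bound supplied.\<close>

lemmas bounded_intros = bounded_family_add bounded_family_minus bounded_family_mult bounded_family_adj
  bounded_family_E bounded_family_const bounded_family_smult[OF _ bounded_scalars(1)]
  bounded_family_smult[OF _ bounded_scalars(2)] bounded_family_smult[OF _ bounded_scalars(3)]
  bounded_family_smult[OF _ bounded_scalars(4)]

lemma bounded_L: "bounded_family n L"
  unfolding L_def[abs_def] by (intro bounded_intros) auto

lemma bounded_R: "bounded_family n R"
  unfolding R_def[abs_def] by (intro bounded_intros bounded_L) auto

lemma bounded_T: "bounded_family n T"
  unfolding T_def[abs_def] by (intro bounded_intros) auto

lemma bounded_K: "bounded_family n K"
  unfolding K_def[abs_def] Q_def[abs_def]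
  by (intro bounded_family_smult[where f = "\<lambda>_. complex_of_real (sqrt (s i))" and H = "cmod (complex_of_real (sqrt (s i)))"]
      bounded_intros) auto

lemma bounded_PL: "bounded_family n (\<lambda>\<epsilon>. P + complex_of_real \<epsilon> \<cdot>\<^sub>m L \<epsilon>)"
  by (intro bounded_intros bounded_L) auto

lemma dirichlet_bound:
  obtains k where "\<And>\<epsilon>. 0 < \<epsilon> \<Longrightarrow> \<epsilon> < 1 \<Longrightarrow> dirichlet2 n E (X \<epsilon>) \<le> \<epsilon>\<^sup>2 * k"
proof -
  have "bounded_family n (\<lambda>\<epsilon>. S (1/2) * adj (K \<epsilon>) * S (1/2) * (E (K \<epsilon>) - K \<epsilon>))"
    by (intro bounded_intros bounded_K) auto
  then obtain k where k: "\<And>\<epsilon>. 0 < \<epsilon> \<Longrightarrow> \<epsilon> < 1 \<Longrightarrow>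
      \<bar>Re (mtrace (S (1/2) * adj (K \<epsilon>) * S (1/2) * (E (K \<epsilon>) - K \<epsilon>)))\<bar> \<le> k"
    using bounded_family_mtrace by blast
  show ?thesis
  proof (rule that)
    fix \<epsilon> :: real assume \<epsilon>: "0 < \<epsilon>" "\<epsilon> < 1"
    have "\<epsilon>\<^sup>2 * - Re (mtrace (S (1/2) * adj (K \<epsilon>) * S (1/2) * (E (K \<epsilon>) - K \<epsilon>))) \<le> \<epsilon>\<^sup>2 * k"
      using k[OF \<epsilon>] by (intro mult_left_mono) auto
    then show "dirichlet2 n E (X \<epsilon>) \<le> \<epsilon>\<^sup>2 * k" unfolding dirichlet_X[OF \<epsilon>] by simp
  qed
qed

text \<open>This is \<open>mtrace_xlnx_le\<close> with \<delta> = \<epsilon>^2. As G - G^2 =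
  \<epsilon>^2 R, the quadratic term divided by \<delta> is again of order \<epsilon>^2, and only
  the logarithmic term is larger.\<close>

lemma mtrace_xlnx_G_bound:
  obtains k1 k2 where "\<And>\<epsilon>. 0 < \<epsilon> \<Longrightarrow> \<epsilon> < 1 \<Longrightarrow>
    Re (mtrace (G \<epsilon> * matfun n ln (G \<epsilon>))) \<le> \<epsilon>\<^sup>2 * (ln (\<epsilon>\<^sup>2) * (\<kappa>\<^sup>2 * r0 - \<epsilon> * k1) + k2)"
proof -
  have bkT: "bounded_family n (\<lambda>\<epsilon>. T \<epsilon> * (1\<^sub>m n - P))"
    and bkL: "bounded_family n (\<lambda>\<epsilon>. R \<epsilon> * L \<epsilon>)" and bkR: "bounded_family n (\<lambda>\<epsilon>. R \<epsilon> * R \<epsilon>)"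
    by (intro bounded_intros bounded_T bounded_R bounded_L; simp)+
  obtain kT where kT: "\<And>\<epsilon>. 0 < \<epsilon> \<Longrightarrow> \<epsilon> < 1 \<Longrightarrow> \<bar>Re (mtrace (T \<epsilon> * (1\<^sub>m n - P)))\<bar> \<le> kT"
    using bounded_family_mtrace[of n "\<lambda>\<epsilon>. T \<epsilon> * (1\<^sub>m n - P)"] bkT by blast
  obtain kL where kL: "\<And>\<epsilon>. 0 < \<epsilon> \<Longrightarrow> \<epsilon> < 1 \<Longrightarrow> \<bar>Re (mtrace (R \<epsilon> * L \<epsilon>))\<bar> \<le> kL"
    using bounded_family_mtrace[of n "\<lambda>\<epsilon>. R \<epsilon> * L \<epsilon>"] bkL by blast
  obtain kR where kR: "\<And>\<epsilon>. 0 < \<epsilon> \<Longrightarrow> \<epsilon> < 1 \<Longrightarrow> \<bar>Re (mtrace (R \<epsilon> * R \<epsilon>))\<bar> \<le> kR"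
    using bounded_family_mtrace[of n "\<lambda>\<epsilon>. R \<epsilon> * R \<epsilon>"] bkR by blast
  obtain kG where kG: "\<And>\<epsilon>. 0 < \<epsilon> \<Longrightarrow> \<epsilon> < 1 \<Longrightarrow> \<bar>Re (mtrace ((P + complex_of_real \<epsilon> \<cdot>\<^sub>m L \<epsilon>) * R \<epsilon>))\<bar> \<le> kG"
    using bounded_family_mtrace[OF bounded_family_mult[OF bounded_PL bounded_R]] by blast
  show ?thesis
  proof (rule that[of "kT + kL" "kR + kG"])
    fix \<epsilon> :: real assume \<epsilon>: "0 < \<epsilon>" "\<epsilon> < 1"
    let ?a = "complex_of_real (\<epsilon>\<^sup>2)"
    have Gc: "G \<epsilon> \<in> carrier_mat n n" unfolding G_eq[OF \<epsilon>] by simp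
    \<comment> \<open>Replaces the cut-off 1 - G by 1 - P, at the cost of a term of order
      \<open>\<epsilon>\<close>.\<close>
    have "1\<^sub>m n - G \<epsilon> = (1\<^sub>m n - P) - complex_of_real \<epsilon> \<cdot>\<^sub>m L \<epsilon>"
      unfolding G_eq[OF \<epsilon>] using carrier_matD[OF P_carrier] carrier_matD[OF L_carrier] by (intro eq_matI) auto
    then have "mtrace (R \<epsilon> * (1\<^sub>m n - G \<epsilon>)) = mtrace (R \<epsilon> * (1\<^sub>m n - P)) - complex_of_real \<epsilon> * mtrace (R \<epsilon> * L \<epsilon>)"
      by (simp add: square_distrib(3)[of "R \<epsilon>" n "1\<^sub>m n - P"] square_smult[of _ n] mtrace_minus[of _ n] mtrace_smult[of _ n])
    then have "Re (mtrace (R \<epsilon> * (1\<^sub>m n - G \<epsilon>))) = Re (mtrace (R \<epsilon> * (1\<^sub>m n - P))) - \<epsilon> * Re (mtrace (R \<epsilon> * L \<epsilon>))"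
      by simp
    also have "\<dots> \<ge> (\<kappa>\<^sup>2 * r0 - \<epsilon> * kT) - \<epsilon> * kL"
    proof -
      have "\<epsilon> * Re (mtrace (T \<epsilon> * (1\<^sub>m n - P))) \<le> \<epsilon> * kT" "\<epsilon> * Re (mtrace (R \<epsilon> * L \<epsilon>)) \<le> \<epsilon> * kL"
        using kT[OF \<epsilon>] kL[OF \<epsilon>] \<epsilon> by (auto intro!: mult_left_mono)
      then show ?thesis using mtrace_defect[OF \<epsilon>] by linarith
    qed
    finally have low: "Re (mtrace (R \<epsilon> * (1\<^sub>m n - G \<epsilon>))) \<ge> \<kappa>\<^sup>2 * r0 - \<epsilon> * (kT + kL)"
      by (simp add: algebra_simps)
    \<comment> \<open>The logarithm is nonpositive, so the lower bound on the trace becomes an upper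
      bound on the product.\<close>
    have "ln (\<epsilon>\<^sup>2) \<le> 0" using \<epsilon> by (simp add: power_le_one)
    then have ln_low: "ln (\<epsilon>\<^sup>2) * Re (mtrace (R \<epsilon> * (1\<^sub>m n - G \<epsilon>))) \<le> ln (\<epsilon>\<^sup>2) * (\<kappa>\<^sup>2 * r0 - \<epsilon> * (kT + kL))"
      using low by (intro mult_left_mono_neg)
    have "Re (mtrace (G \<epsilon> * matfun n ln (G \<epsilon>)))
      \<le> ln (\<epsilon>\<^sup>2) * Re (mtrace (?a \<cdot>\<^sub>m R \<epsilon> * (1\<^sub>m n - G \<epsilon>))) + Re (mtrace (?a \<cdot>\<^sub>m R \<epsilon> * (?a \<cdot>\<^sub>m R \<epsilon>))) / \<epsilon>\<^sup>2
        - Re (mtrace (G \<epsilon> * (?a \<cdot>\<^sub>m R \<epsilon>)))"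
      using mtrace_xlnx_le[OF psd_G[OF \<epsilon>], of "\<epsilon>\<^sup>2"] \<epsilon> unfolding G_defect[OF \<epsilon>] by simp
    also have "\<dots> = \<epsilon>\<^sup>2 * (ln (\<epsilon>\<^sup>2) * Re (mtrace (R \<epsilon> * (1\<^sub>m n - G \<epsilon>))) + Re (mtrace (R \<epsilon> * R \<epsilon>)) - Re (mtrace (G \<epsilon> * R \<epsilon>)))"
      using \<epsilon> Gc by (simp add: square_smult[of _ n] mtrace_smult[of _ n] algebra_simps del: of_real_power)
        (simp add: power2_eq_square power4_eq_xxxx)
    also have "\<dots> \<le> \<epsilon>\<^sup>2 * (ln (\<epsilon>\<^sup>2) * (\<kappa>\<^sup>2 * r0 - \<epsilon> * (kT + kL)) + (kR + kG))"
      using ln_low kR[OF \<epsilon>] kG[OF \<epsilon>] unfolding G_eq[OF \<epsilon>, symmetric] by (intro mult_left_mono) auto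
    finally show "Re (mtrace (G \<epsilon> * matfun n ln (G \<epsilon>)))
        \<le> \<epsilon>\<^sup>2 * (ln (\<epsilon>\<^sup>2) * (\<kappa>\<^sup>2 * r0 - \<epsilon> * (kT + kL)) + (kR + kG))" .
  qed
qed

text \<open>After division by \<epsilon>^2 the Dirichlet form stays bounded above, while the entropy
  grows at least like -r ln (\<epsilon>^2) / 2n with r > 0.\<close>

lemma no_log_sobolev:
  assumes \<alpha>: "\<alpha> \<ge> 0" and LS: "\<forall>X. psd n X \<longrightarrow> \<alpha> * ent2 n E X \<le> dirichlet2 n E X"
  shows "\<alpha> = 0"
proof (rule ccontr)
  assume "\<alpha> \<noteq> 0"
  then have \<alpha>0: "\<alpha> > 0" using \<alpha> by simp
  have n: "real n > 0" using i by simp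
  obtain kD where kD: "\<And>\<epsilon>. 0 < \<epsilon> \<Longrightarrow> \<epsilon> < 1 \<Longrightarrow> dirichlet2 n E (X \<epsilon>) \<le> \<epsilon>\<^sup>2 * kD"
    using dirichlet_bound by blast
  obtain k1 k2 where k: "\<And>\<epsilon>. 0 < \<epsilon> \<Longrightarrow> \<epsilon> < 1 \<Longrightarrow>
    Re (mtrace (G \<epsilon> * matfun n ln (G \<epsilon>))) \<le> \<epsilon>\<^sup>2 * (ln (\<epsilon>\<^sup>2) * (\<kappa>\<^sup>2 * r0 - \<epsilon> * k1) + k2)"
    using mtrace_xlnx_G_bound by blast
  define r where "r = \<kappa>\<^sup>2 * r0"
  have r: "r > 0" unfolding r_def using r0_pos \<kappa>_pos by simp
  define a where "a = s i * (ln (s i) - ln (s j)) / 2"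
  have bound: "\<alpha> * (a - (ln (\<epsilon>\<^sup>2) * (r - \<epsilon> * k1) + k2) / (2 * real n)) \<le> kD" if \<epsilon>: "0 < \<epsilon>" "\<epsilon> < 1" for \<epsilon>
  proof -
    have "Re (mtrace (G \<epsilon> * matfun n ln (G \<epsilon>))) / (2 * real n) \<le> \<epsilon>\<^sup>2 * (ln (\<epsilon>\<^sup>2) * (r - \<epsilon> * k1) + k2) / (2 * real n)"
      using k[OF \<epsilon>] n unfolding r_def by (intro divide_right_mono) auto
    moreover have ent: "ent2 n E (X \<epsilon>) = \<epsilon>\<^sup>2 * a - Re (mtrace (G \<epsilon> * matfun n ln (G \<epsilon>))) / (2 * real n)"
      unfolding ent_X[OF \<epsilon>] a_def by simp
    ultimately have "\<epsilon>\<^sup>2 * (a - (ln (\<epsilon>\<^sup>2) * (r - \<epsilon> * k1) + k2) / (2 * real n)) \<le> ent2 n E (X \<epsilon>)"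
      by (simp add: ent right_diff_distrib)
    then have "\<alpha> * (\<epsilon>\<^sup>2 * (a - (ln (\<epsilon>\<^sup>2) * (r - \<epsilon> * k1) + k2) / (2 * real n))) \<le> \<alpha> * ent2 n E (X \<epsilon>)"
      using \<alpha> by (intro mult_left_mono)
    also have "\<dots> \<le> dirichlet2 n E (X \<epsilon>)" using LS psd_X[OF \<epsilon>] by blast
    also have "\<dots> \<le> \<epsilon>\<^sup>2 * kD" by (rule kD[OF \<epsilon>])
    finally have "\<epsilon>\<^sup>2 * (\<alpha> * (a - (ln (\<epsilon>\<^sup>2) * (r - \<epsilon> * k1) + k2) / (2 * real n))) \<le> \<epsilon>\<^sup>2 * kD"
      by (simp add: mult.left_commute)
    then show ?thesis using \<epsilon> by simp
  qed
  \<comment> \<open>The product \<epsilon> ln (\<epsilon>^2) tends to 0, so the sign of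
    \<open>k1\<close> does not matter and \<open>r > 0\<close> decides.\<close>
  have "filterlim (\<lambda>\<epsilon>. \<alpha> * (a - (ln (\<epsilon>\<^sup>2) * (r - \<epsilon> * k1) + k2) / (2 * real n))) at_top (at_right (0::real))"
    using \<alpha>0 r n by real_asymp
  then have "eventually (\<lambda>\<epsilon>. \<alpha> * (a - (ln (\<epsilon>\<^sup>2) * (r - \<epsilon> * k1) + k2) / (2 * real n)) > kD) (at_right 0)"
    by (simp add: filterlim_at_top_dense)
  moreover have "eventually (\<lambda>\<epsilon>. \<epsilon> \<in> {0<..<1}) (at_right (0::real))"
    by (rule eventually_at_right_real) simp
  ultimately have "eventually (\<lambda>\<epsilon>::real. False) (at_right 0)"
    by eventually_elim (use bound in \<open>force simp: not_less[symmetric]\<close>)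
  then show False by simp
qed

end

theorem theorem5p1:
  fixes n :: nat and N :: "complex mat set" and E :: "complex mat \<Rightarrow> complex mat"
    and \<alpha> :: real
  assumes "star_subalgebra n N"
    and "N \<noteq> {c \<cdot>\<^sub>m 1\<^sub>m n | c. True}"
    and "N \<noteq> carrier_mat n n"
    and "cond_exp n N E"
    and "det (sigma_tr n E) \<noteq> 0"
    and "\<alpha> \<ge> 0"
    and "\<forall>X. psd n X \<longrightarrow> \<alpha> * ent2 n E X \<le> dirichlet2 n E X"
  shows "\<alpha> = 0"
proof -
  interpret proper_conditional_expectation n N E
    using assms by unfold_locales
  obtain U s p where U: "unitary n U" "sig = sform n U s"
    "sform n U (\<lambda>k. if k \<in> p then 1 else 0) \<in> N" "\<exists>i<n. i \<in> p" "\<exists>j<n. j \<notin> p"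
    using diagonalising_frame by blast
  obtain i j where ij: "i < n" "j < n" "i \<in> p" "j \<notin> p" "eunit n U i j \<notin> N"
    using off_diagonal_unit[OF U(1,4,5)] by blast
  interpret test_family n N E U s p i j
    using U ij by unfold_locales
  show ?thesis using no_log_sobolev assms by blast
qed

end
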